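(* For $\alpha\in\mathbb{R}$ let $$\mathscr{G}(\alpha)=\left\{x\in(0,1)\setminus\mathbb{Q}\,:\,\limsup_{n\to\infty}\frac{\log q_n^2}{\log\left|x-\frac{p_n}{q_n}\right|}=\alpha\right\},$$ where $\frac{p_n}{q_n}=\frac{p_n(x)}{q_n(x)}$ are the convergents of the continued fraction expansion of $x$. Then for every $\alpha\in(-1,0]$, the Hausdorff dimension of $\mathscr{G}(\alpha)$ is $|\alpha|$ and $\mathcal{H}^{|\alpha|}(\mathscr{G}(\alpha))=\infty$. Moreover, if $\alpha\notin[-1,0]$, then $\mathscr{G}(\alpha)=\emptyset$.
   Context: For irrational $x\in(0,1)$, write $x=[a_1,a_2,\ldots]=\cfrac{1}{a_1+\cfrac{1}{a_2+\cfrac{1}{a_3+\cdots}}}$ for its regular continued fraction expansion, with partial quotients $a_i\in\mathbb{Z}_{\ge1}$, and let $\frac{p_n}{q_n}=[a_1,\ldots,a_n]$ (in lowest terms, $q_n>0$) be its $n$-th convergent. $\mathcal{H}^s$ denotes $s$-dimensional Hausdorff measure (so $\mathcal{H}^0$ is counting measure). *)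

theory Defs
  imports "HOL-Analysis.Analysis"
begin

section \<open>Regular continued fractions\<close>

definition gauss_map :: "real \<Rightarrow> real" where
  "gauss_map x = frac (1 / x)"

text \<open>Partial quotients are indexed from 1; only irrational \<open>x\<close> in \<open>(0,1)\<close> are of interest,
  for which no iterate of the Gauss map vanishes.\<close>

definition partial_quotient :: "real \<Rightarrow> nat \<Rightarrow> int" where
  "partial_quotient x n = \<lfloor>1 / (gauss_map ^^ (n - 1)) x\<rfloor>"

fun cf_value :: "int list \<Rightarrow> rat" where
  "cf_value [] = 0"
| "cf_value (a # as) = 1 / (of_int a + cf_value as)"

definition convergent_cf :: "real \<Rightarrow> nat \<Rightarrow> rat" where
  "convergent_cf x n = cf_value (map (partial_quotient x) [1..<Suc n])"

text \<open>\<^const>\<open>quotient_of\<close> returns the coprime representation with positive denominator.\<close>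

definition conv_num :: "real \<Rightarrow> nat \<Rightarrow> int" where
  "conv_num x n = fst (quotient_of (convergent_cf x n))"

definition conv_denom :: "real \<Rightarrow> nat \<Rightarrow> int" where
  "conv_denom x n = snd (quotient_of (convergent_cf x n))"


section \<open>Hausdorff measure and dimension\<close>

text \<open>The weight \<open>|U|\<^sup>s\<close> of a covering set. The case \<open>s = 0\<close> is separate because \<open>0 powr 0 = 0\<close>,
  whereas singletons must have weight 1 for the zero-dimensional measure to be the counting measure.\<close>

definition hausdorff_weight :: "real \<Rightarrow> 'a::metric_space set \<Rightarrow> ennreal" where
  "hausdorff_weight s U =
     (if U = {} then 0 else if s = 0 then 1 else ennreal (diameter U powr s))"

text \<open>Boundedness is required because \<^const>\<open>diameter\<close> is unspecified on unbounded sets.\<close>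

definition hausdorff_premeasure :: "real \<Rightarrow> real \<Rightarrow> 'a::metric_space set \<Rightarrow> ennreal" where
  "hausdorff_premeasure s \<delta> E =
     (INF U \<in> {U :: nat \<Rightarrow> 'a set.
                 E \<subseteq> (\<Union>i. U i) \<and> (\<forall>i. bounded (U i) \<and> diameter (U i) \<le> \<delta>)}.
        \<Sum>i. hausdorff_weight s (U i))"

text \<open>The premeasure is antitone in \<open>\<delta>\<close>, so the limit as \<open>\<delta>\<close> tends to 0 is a supremum.\<close>

definition hausdorff_measure :: "real \<Rightarrow> 'a::metric_space set \<Rightarrow> ennreal" where
  "hausdorff_measure s E = (SUP \<delta> \<in> {0<..}. hausdorff_premeasure s \<delta> E)"

definition hausdorff_dim :: "'a::metric_space set \<Rightarrow> ereal" where
  "hausdorff_dim E = (INF s \<in> {s. 0 \<le> s \<and> hausdorff_measure s E = 0}. ereal s)"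


section \<open>The level sets\<close>

definition level_set_G :: "real \<Rightarrow> real set" where
  "level_set_G \<alpha> =
     {x. 0 < x \<and> x < 1 \<and> x \<notin> \<rat> \<and>
         limsup (\<lambda>n. ereal (ln ((of_int (conv_denom x n))\<^sup>2) /
                            ln \<bar>x - of_int (conv_num x n) / of_int (conv_denom x n)\<bar>)) = ereal \<alpha>}"

end

theory Submission
  imports Defs "HOL-Real_Asymp.Real_Asymp"
begin

text \<open>
  Write \<open>s = \<bar>\<alpha>\<bar>\<close>. Since \<open>\<bar>x - p\<^sub>n/q\<^sub>n\<bar> < 1/q\<^sub>n\<^sup>2\<close>, the quotients in the definition of the level set lie in
  \<open>[-1, 0]\<close>, which settles \<open>\<alpha> \<notin> [-1, 0]\<close>; and by Legendre's theorem (good approximations are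
  convergents) the level set of \<open>\<alpha> = -s\<close> consists of the irrationals whose irrationality exponent is
  exactly \<open>2/s\<close>. The theorem is thus a form of the Jarnik-Besicovitch theorem.

  Upper bound: for \<open>\<theta> t > 2\<close> the balls of radius \<open>q powr -\<theta>\<close> about the fractions \<open>p/q\<close> with \<open>q \<ge> k\<close>
  cover all points with infinitely many approximations of order \<open>\<theta>\<close>, and the sum of the \<open>t\<close>-th powers
  of their diameters is the tail of a convergent series (\<open>hausdorff_measure_well_approximable\<close>).

  Lower bound: let \<open>\<psi>\<close> be such that \<open>Q\<^sup>2 \<psi>(Q)\<^sup>s\<close> tends to infinity. The set of irrationals that for
  infinitely many \<open>Q\<close> are within \<open>\<psi>(Q)\<close> of a fraction with denominator at most \<open>Q\<close> then has
  infinite \<open>s\<close>-dimensional measure (\<open>hausdorff_measure_approximable_set\<close>). No measure on a Cantor set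
  is constructed. Instead, given a covering whose \<open>s\<close>-th powers of diameters have a finite sum and whose
  sets are small, nested balls are chosen one at a time so as to escape every set of the covering
  (\<open>exists_avoiding\<close>). The invariant is that the covering sets meeting the current ball have total
  length at most a fixed small multiple of its radius. A ball of radius \<open>R\<close> contains at least
  \<open>R Q\<^sup>2 / 16\<close> fractions with denominator at most \<open>Q\<close>, and they are \<open>1/Q\<^sup>2\<close>-separated. Hence large
  covering sets spoil only few of the balls of radius \<open>\<psi>(Q)\<close> about these fractions, the small covering
  sets are spread over so many balls that on average they contribute next to nothing, and one of the
  balls inherits the invariant.

  For \<open>s > 0\<close> the choice \<open>\<psi>(Q) = Q powr (-2/s) * (1 + ln Q)\<close> (with \<open>Q\<close> shifted by one) yields only
  points of exponent at least \<open>2/s\<close>. Those of larger exponent form a countable union of sets that are null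
  for the \<open>s\<close>-dimensional measure by the upper bound, so the points of exponent exactly \<open>2/s\<close>
  still have infinite measure. For \<open>s = 0\<close> one takes \<open>\<psi>(Q) = exp(-Q)\<close>, which produces Liouville numbers.
\<close>

section \<open>Convergents of a continued fraction\<close>

text \<open>Index \<open>n + 1\<close> belongs to the \<open>n\<close>-th convergent and index \<open>0\<close> to the conventional \<open>(-1)\<close>-st one
  \<open>1/0\<close>; with this shift the recursion needs no exceptional case at the start.\<close>

fun cf_num :: "(nat \<Rightarrow> int) \<Rightarrow> nat \<Rightarrow> int" where
  "cf_num a 0 = 1"
| "cf_num a (Suc 0) = 0"
| "cf_num a (Suc (Suc n)) = a (Suc n) * cf_num a (Suc n) + cf_num a n"

fun cf_den :: "(nat \<Rightarrow> int) \<Rightarrow> nat \<Rightarrow> int" where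
  "cf_den a 0 = 0"
| "cf_den a (Suc 0) = 1"
| "cf_den a (Suc (Suc n)) = a (Suc n) * cf_den a (Suc n) + cf_den a n"

text \<open>Leaving the innermost entry \<open>t\<close> free serves both uses of the same recursion: \<open>t = 0\<close> over the
  rationals gives the convergent, and \<open>t\<close> an iterate of the Gauss map gives \<open>x\<close> itself.\<close>

definition cf_tail :: "(nat \<Rightarrow> int) \<Rightarrow> nat \<Rightarrow> 'a::linordered_field \<Rightarrow> 'a" where
  "cf_tail a n t = foldr (\<lambda>k v. 1 / (of_int k + v)) (map a [1..<Suc n]) t"

lemma cf_tail_0 [simp]: "cf_tail a 0 t = t"
  by (simp add: cf_tail_def)

lemma cf_tail_Suc: "cf_tail a (Suc n) t = cf_tail a n (1 / (of_int (a (Suc n)) + t))"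
  by (simp add: cf_tail_def)

lemma cf_value_eq_cf_tail: "cf_value (map a [1..<Suc n]) = cf_tail a n 0"
proof -
  have "cf_value as = foldr (\<lambda>k v. 1 / (of_int k + v)) as 0" for as
    by (induction as) auto
  then show ?thesis by (simp add: cf_tail_def)
qed

lemma cf_num_nonneg: "(\<And>i. a i \<ge> 1) \<Longrightarrow> cf_num a n \<ge> 0"
  by (induction a n rule: cf_num.induct) (auto simp: order.trans[OF zero_le_one])

lemma cf_den_nonneg: "(\<And>i. a i \<ge> 1) \<Longrightarrow> cf_den a n \<ge> 0"
  by (induction a n rule: cf_den.induct) (auto simp: order.trans[OF zero_le_one])

lemma cf_den_Suc_pos:
  assumes "\<And>i. a i \<ge> 1" shows "cf_den a (Suc n) \<ge> 1"
proof (induction n)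
  case (Suc n)
  have "1 * 1 \<le> a (Suc n) * cf_den a (Suc n)"
    using Suc assms[of "Suc n"] by (intro mult_mono) auto
  then show ?case using cf_den_nonneg[of a n, OF assms] by simp
qed simp

lemma cf_num_le_den:
  assumes "\<And>i. a i \<ge> 1" shows "cf_num a (Suc n) \<le> cf_den a (Suc n)"
proof -
  have "cf_num a (Suc n) \<le> cf_den a (Suc n) \<and> cf_num a (Suc (Suc n)) \<le> cf_den a (Suc (Suc n))"
  proof (induction n)
    case 0 then show ?case using assms[of 1] by simp
  next
    case (Suc n)
    have "a (Suc (Suc n)) * cf_num a (Suc (Suc n)) \<le> a (Suc (Suc n)) * cf_den a (Suc (Suc n))"
      using Suc assms[of "Suc (Suc n)"] by (intro mult_left_mono) auto
    then show ?case using Suc by simp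
  qed
  then show ?thesis by blast
qed

lemma cf_den_step:
  assumes "\<And>i. a i \<ge> 1" shows "cf_den a (Suc (Suc n)) \<ge> cf_den a (Suc n) + cf_den a n"
proof -
  have "1 * cf_den a (Suc n) \<le> a (Suc n) * cf_den a (Suc n)"
    using assms cf_den_nonneg[OF assms] by (intro mult_right_mono) auto
  then show ?thesis by simp
qed

lemma cf_den_ge:
  assumes "\<And>i. a i \<ge> 1" shows "cf_den a (Suc n) \<ge> int n"
proof (induction n)
  case (Suc n)
  show ?case
  proof (cases n)
    case 0 then show ?thesis using assms[of 1] by simp
  next
    case (Suc m)
    then have "cf_den a n \<ge> 1" using cf_den_Suc_pos[of a m, OF assms] by simp
    then show ?thesis using Suc.IH cf_den_step[of a n, OF assms] by linarith
  qed
qed simp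

lemma cf_det: "cf_num a (Suc n) * cf_den a n - cf_num a n * cf_den a (Suc n) = (-1) ^ Suc n"
proof (induction n)
  case (Suc n)
  have "cf_num a (Suc (Suc n)) * cf_den a (Suc n) - cf_num a (Suc n) * cf_den a (Suc (Suc n))
     = - (cf_num a (Suc n) * cf_den a n - cf_num a n * cf_den a (Suc n))"
    by (simp add: algebra_simps)
  then show ?case unfolding Suc by simp
qed simp

lemma coprime_cf_num_den: "coprime (cf_num a (Suc n)) (cf_den a (Suc n))"
proof (rule coprimeI)
  fix c assume "c dvd cf_num a (Suc n)" "c dvd cf_den a (Suc n)"
  then have "c dvd (-1) ^ Suc n"
    unfolding cf_det[of a n, symmetric] by simp
  then show "is_unit c"
    by (metis dvd_minus_iff dvd_trans minus_one_mult_self dvd_triv_left)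
qed

text \<open>Appending a partial quotient substitutes \<open>1 / (a + t)\<close> for \<open>t\<close> in the Moebius transformation,
  which produces exactly the two-term recursion.\<close>

lemma cf_tail_eq:
  fixes t :: "'a::linordered_field"
  assumes a: "\<And>i. a i \<ge> 1" and "t \<ge> 0"
  shows "cf_tail a n t = (of_int (cf_num a (Suc n)) + of_int (cf_num a n) * t) /
                         (of_int (cf_den a (Suc n)) + of_int (cf_den a n) * t)"
  using \<open>t \<ge> 0\<close>
proof (induction n arbitrary: t)
  case (Suc n)
  have pos: "of_int (a (Suc n)) + t > 0"
    using a[of "Suc n"] Suc.prems
    by (metis add_pos_nonneg of_int_0_less_iff zero_less_one order.strict_trans2)
  have "of_int (cf_den a (Suc n)) > (0::'a)" "of_int (cf_den a n) \<ge> (0::'a)"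
    using cf_den_Suc_pos[of a n, OF a] cf_den_nonneg[of a n, OF a] by simp_all
  then have pos2: "of_int (cf_den a (Suc n)) * (of_int (a (Suc n)) + t) + of_int (cf_den a n) > (0::'a)"
    using pos by (simp add: add_pos_nonneg)
  show ?case
    unfolding cf_tail_Suc using pos pos2 Suc.IH[of "1 / (of_int (a (Suc n)) + t)"]
    by (simp add: divide_simps) (simp add: algebra_simps)
qed simp

lemma gauss_map_irrational:
  assumes "0 < t" "t < 1" "t \<notin> \<rat>"
  shows "0 < gauss_map t" "gauss_map t < 1" "gauss_map t \<notin> \<rat>" "\<lfloor>1 / t\<rfloor> \<ge> 1"
    "t = 1 / (of_int \<lfloor>1 / t\<rfloor> + gauss_map t)"
proof -
  have g: "gauss_map t = 1 / t - of_int \<lfloor>1 / t\<rfloor>" by (simp add: gauss_map_def frac_def)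
  have "1 / t \<notin> \<rat>"
    using assms by (metis Rats_inverse inverse_eq_divide inverse_inverse_eq)
  then show r: "gauss_map t \<notin> \<rat>"
    unfolding g by (metis Rats_add Rats_of_int diff_add_cancel)
  then have "gauss_map t \<noteq> 0" by auto
  then show "0 < gauss_map t" using frac_ge_0[of "1/t"] by (simp add: gauss_map_def)
  show "gauss_map t < 1" by (simp add: gauss_map_def frac_lt_1)
  show "\<lfloor>1 / t\<rfloor> \<ge> 1" using assms by (simp add: le_floor_iff)
  show "t = 1 / (of_int \<lfloor>1 / t\<rfloor> + gauss_map t)" unfolding g by simp
qed

text \<open>The standing situation of continued fraction theory. Partial quotients are indexed from 1; the
  value 1 given to the index 0 in \<open>a\<close> merely makes all entries positive.\<close>

locale irrational_unit =
  fixes x :: real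
  assumes x_pos: "0 < x" and x_less_1: "x < 1" and x_irrat: "x \<notin> \<rat>"
begin

abbreviation "t \<equiv> \<lambda>n. (gauss_map ^^ n) x"
abbreviation "a \<equiv> \<lambda>n. if n = 0 then 1 else partial_quotient x n"

lemma t_irrational: "0 < t n \<and> t n < 1 \<and> t n \<notin> \<rat>"
  using x_pos x_less_1 x_irrat by (induction n) (auto simp: gauss_map_irrational)

lemma a_ge_1: "a n \<ge> 1"
  using gauss_map_irrational(4)[of "t (n - 1)"] t_irrational[of "n - 1"] by (simp add: partial_quotient_def)

lemma t_Suc: "t n = 1 / (of_int (a (Suc n)) + t (Suc n))"
  using gauss_map_irrational(5)[of "t n"] t_irrational[of n]
  by (simp add: partial_quotient_def)

lemma x_eq_cf_tail: "x = cf_tail a n (t n)"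
proof (induction n)
  case (Suc n)
  then show ?case unfolding cf_tail_Suc t_Suc[symmetric] .
qed simp

abbreviation "p \<equiv> conv_num x"
abbreviation "q \<equiv> conv_denom x"

lemma convergent_eq: "p n = cf_num a (Suc n)" "q n = cf_den a (Suc n)"
proof -
  have "map (partial_quotient x) [1..<Suc n] = map a [1..<Suc n]" by auto
  then have "convergent_cf x n = cf_tail a n 0"
    unfolding convergent_cf_def using cf_value_eq_cf_tail[of a n] by metis
  also have "\<dots> = of_int (cf_num a (Suc n)) / of_int (cf_den a (Suc n))"
    using cf_tail_eq[of a "0::rat" n] a_ge_1 by simp
  finally have "quotient_of (convergent_cf x n) = (cf_num a (Suc n), cf_den a (Suc n))"
    using coprime_cf_num_den[of a n] cf_den_Suc_pos[of a n, OF a_ge_1]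
    by (simp add: Fract_of_int_quotient[symmetric] quotient_of_Fract normalize_stable)
  then show "p n = cf_num a (Suc n)" "q n = cf_den a (Suc n)"
    by (simp_all add: conv_num_def conv_denom_def)
qed

lemma q_pos: "q n \<ge> 1" and q_ge: "q n \<ge> int n" and p_nonneg: "p n \<ge> 0" and p_le_q: "p n \<le> q n"
  unfolding convergent_eq
  by (rule cf_den_Suc_pos cf_den_ge cf_num_nonneg cf_num_le_den; rule a_ge_1)+

lemma det: "\<bar>p (Suc n) * q n - p n * q (Suc n)\<bar> = 1"
  unfolding convergent_eq cf_det by (simp add: power_abs)

text \<open>Inserting \<open>x = (p\<^sub>n + p\<^sub>n\<^sub>-\<^sub>1 t\<^sub>n) / (q\<^sub>n + q\<^sub>n\<^sub>-\<^sub>1 t\<^sub>n)\<close>, the numerator of the error is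
  \<open>t\<^sub>n\<close> times the determinant, so the sign alternates.\<close>

lemma error_eq: 
  "of_int (q n) * x - of_int (p n) = (-1) ^ n * (t n / (of_int (q n) + of_int (cf_den a n) * t n))"
proof -
  have qp: "real_of_int (q n) \<ge> 1" "real_of_int (cf_den a n) * t n \<ge> 0"
    using q_pos[of n] cf_den_nonneg[of a n, OF a_ge_1] t_irrational[of n] by auto
  then have d: "of_int (q n) + of_int (cf_den a n) * t n > 0" by linarith
  have x: "x = (of_int (p n) + of_int (cf_num a n) * t n) / (of_int (q n) + of_int (cf_den a n) * t n)"
    unfolding convergent_eq
  proof (rule trans[OF x_eq_cf_tail[of n] cf_tail_eq])
    show "1 \<le> a i" for i by (rule a_ge_1)
    show "0 \<le> t n" using t_irrational[of n] by (intro less_imp_le) blast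
  qed
  have det: "of_int (p n) * of_int (cf_den a n) - of_int (cf_num a n) * of_int (q n) = (-1::real) ^ Suc n"
    using arg_cong[OF cf_det[of a n], of real_of_int] unfolding convergent_eq by simp
  have "(of_int (q n) * x - of_int (p n)) * (of_int (q n) + of_int (cf_den a n) * t n)
     = of_int (q n) * (of_int (p n) + of_int (cf_num a n) * t n)
       - of_int (p n) * (of_int (q n) + of_int (cf_den a n) * t n)"
  proof -
    have "x * D = N" if "x = N / D" "D > 0" for D N :: real using that by simp
    from this[OF x d] show ?thesis by (simp only: left_diff_distrib mult.assoc)
  qed
  also have "\<dots> = - t n * (of_int (p n) * of_int (cf_den a n) - of_int (cf_num a n) * of_int (q n))"
    by (simp add: algebra_simps)
  also have "\<dots> = (-1) ^ n * t n" unfolding det by simp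
  finally show ?thesis using d by (simp add: field_simps)
qed

lemma error_pos: "(-1) ^ n * (of_int (q n) * x - of_int (p n)) > 0"
  and error_less: "\<bar>of_int (q n) * x - of_int (p n)\<bar> < 1 / of_int (q n)"
proof -
  have qp: "real_of_int (q n) \<ge> 1" and ge: "real_of_int (cf_den a n) * t n \<ge> 0"
    using q_pos[of n] cf_den_nonneg[of a n, OF a_ge_1] t_irrational[of n] by auto
  then have d: "of_int (q n) + of_int (cf_den a n) * t n > 0" by linarith
  then have pos: "t n / (of_int (q n) + of_int (cf_den a n) * t n) > 0"
    using t_irrational[of n] by simp
  then show "(-1) ^ n * (of_int (q n) * x - of_int (p n)) > 0" unfolding error_eq
    by (simp flip: mult.assoc power_add)
  have "t n / (of_int (q n) + of_int (cf_den a n) * t n) < 1 / (of_int (q n) + of_int (cf_den a n) * t n)"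
    using d t_irrational[of n] by (intro divide_strict_right_mono) auto
  also have "\<dots> \<le> 1 / of_int (q n)"
    using qp ge by (intro divide_left_mono) auto
  finally show "\<bar>of_int (q n) * x - of_int (p n)\<bar> < 1 / of_int (q n)"
    unfolding error_eq abs_mult power_abs abs_of_pos[OF pos] by simp
qed

lemma approx_less: "\<bar>x - of_int (p n) / of_int (q n)\<bar> < 1 / (of_int (q n))\<^sup>2"
proof -
  have qp: "real_of_int (q n) \<ge> 1" using q_pos[of n] by simp
  then have "\<bar>x - of_int (p n) / of_int (q n)\<bar> = \<bar>of_int (q n) * x - of_int (p n)\<bar> / of_int (q n)"
    by (subst abs_of_pos[symmetric, of "of_int (q n)"], simp, subst abs_divide[symmetric]) (simp add: field_simps)
  also have "\<dots> < (1 / of_int (q n)) / of_int (q n)"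
    using qp error_less by (intro divide_strict_right_mono) auto
  finally show ?thesis by (simp add: power2_eq_square)
qed

lemma approx_pos: "0 < \<bar>x - of_int (p n) / of_int (q n)\<bar>"
proof -
  have "of_int (p n) / of_int (q n) \<in> \<rat>" by simp
  then have "x \<noteq> of_int (p n) / of_int (q n)" using x_irrat by metis
  then show ?thesis by simp
qed

text \<open>Consecutive convergents form a basis of the integer lattice. In this basis \<open>(k, h)\<close> has coordinates
  of opposite signs, because \<open>0 < k < q\<^sub>n\<^sub>+\<^sub>1\<close> and \<open>h/k\<close> is not the \<open>n\<close>-th convergent. The errors of
  the two convergents have opposite signs as well, so their contributions add up instead of cancelling.\<close>

lemma best_approximation:
  assumes "1 \<le> k" "k < q (Suc n)" and ne: "h * q n \<noteq> p n * k"
  shows "\<bar>of_int (q n) * x - of_int (p n)\<bar> \<le> \<bar>of_int k * x - of_int h\<bar>"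
proof -
  define D where "D = p (Suc n) * q n - p n * q (Suc n)"
  \<comment> \<open>The coordinates of \<open>(k, h)\<close> by Cramer's rule; the determinant \<open>D\<close> is its own inverse.\<close>
  define u where "u = D * (k * p (Suc n) - h * q (Suc n))"
  define v where "v = D * (h * q n - k * p n)"
  have "D = 1 \<or> D = -1" using det[of n] unfolding D_def by linarith
  then have DD: "D * D = 1" by auto
  have "u * q n + v * q (Suc n) = k * (D * D)" unfolding u_def v_def
    by (simp add: D_def algebra_simps)
  then have k: "u * q n + v * q (Suc n) = k" using DD by simp
  have "u * p n + v * p (Suc n) = h * (D * D)" unfolding u_def v_def
    by (simp add: D_def algebra_simps)
  then have h: "u * p n + v * p (Suc n) = h" using DD by simp
  have v0: "v \<noteq> 0" using ne \<open>D = 1 \<or> D = -1\<close> by (auto simp: v_def algebra_simps)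
  have q1: "q n \<ge> 1" "q (Suc n) \<ge> 1" using q_pos by auto
  have uv: "u \<ge> 1 \<and> v \<le> -1 \<or> u \<le> -1 \<and> v \<ge> 1"
  proof (cases "v > 0")
    case True
    then have "1 * q (Suc n) \<le> v * q (Suc n)" using q1 by (intro mult_right_mono) auto
    then have "u * q n < 0" using k assms by linarith
    then have "u < 0" using q1 by (simp add: mult_less_0_iff)
    then show ?thesis using True by linarith
  next
    case False
    then have "v * q (Suc n) < 0" using v0 q1 by (simp add: mult_less_0_iff)
    then have "u * q n > 0" using k assms by linarith
    then have "u > 0" using q1 by (simp add: zero_less_mult_iff)
    then show ?thesis using False v0 by linarith
  qed
  define e where "e = (-1) ^ n * (of_int (q n) * x - of_int (p n))"
  define e' where "e' = - ((-1) ^ n * (of_int (q (Suc n)) * x - of_int (p (Suc n))))"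
  have e: "e > 0" "e' > 0" using error_pos[of n] error_pos[of "Suc n"] by (auto simp: e_def e'_def)
  have eq: "(-1) ^ n * (of_int k * x - of_int h) = of_int u * e - of_int v * e'"
    unfolding k[symmetric] h[symmetric] e_def e'_def by (simp add: algebra_simps)
  have "\<bar>of_int k * x - of_int h\<bar> = \<bar>of_int u * e - of_int v * e'\<bar>"
    unfolding eq[symmetric] by (simp add: abs_mult power_abs)
  also have "\<dots> \<ge> e"
    using uv
  proof
    assume "u \<ge> 1 \<and> v \<le> -1"
    then have "1 * e \<le> of_int u * e" "of_int v * e' \<le> 0"
      using e by (auto intro!: mult_right_mono simp: mult_le_0_iff)
    then show ?thesis by linarith
  next
    assume "u \<le> -1 \<and> v \<ge> 1"
    then have "of_int u * e \<le> (-1) * e" "of_int v * e' \<ge> 0"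
      using e by (intro mult_right_mono mult_nonneg_nonneg; simp add: of_int_le_iff[of u "-1", simplified])+
    then show ?thesis by linarith
  qed
  also have "e = \<bar>e\<bar>" using e(1) by simp
  also have "\<bar>e\<bar> = \<bar>of_int (q n) * x - of_int (p n)\<bar>" unfolding e_def abs_mult power_abs by simp
  finally show ?thesis .
qed

text \<open>Pick \<open>n\<close> with \<open>q\<^sub>n \<le> k < q\<^sub>n\<^sub>+\<^sub>1\<close>. The convergent \<open>p\<^sub>n/q\<^sub>n\<close> does at least as well as \<open>h/k\<close>, so if
  the two differed they would be closer together than \<open>1/(k q\<^sub>n)\<close>, the least distance of distinct
  fractions with these denominators.\<close>

theorem legendre:
  assumes "1 \<le> k" and close: "\<bar>x - of_int h / of_int k\<bar> < 1 / (2 * (of_int k)\<^sup>2)"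
  shows "\<exists>n. q n \<le> k \<and> real_of_int h / of_int k = of_int (p n) / of_int (q n)"
proof -
  have ex: "\<exists>m. k < q m" using q_ge[of "nat k + 1"] assms(1) by (intro exI[of _ "nat k + 1"]) linarith
  define m where "m = (LEAST m. k < q m)"
  have m: "k < q m" unfolding m_def using ex by (rule LeastI_ex)
  have "q 0 = 1" by (simp add: convergent_eq)
  then have "m \<noteq> 0" using m assms by (metis not_less)
  then obtain n where n: "m = Suc n" by (cases m) auto
  have "\<not> k < q n" using not_less_Least[of n "\<lambda>m. k < q m"] n by (simp add: m_def)
  then have qn: "q n \<le> k" by simp
  have "h * q n = p n * k"
  proof (rule ccontr)
    assume ne: "h * q n \<noteq> p n * k"
    define e where "e = \<bar>of_int k * x - of_int h\<bar>"
    have kpos: "real_of_int k \<ge> 1" using assms by simp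
    have "e = \<bar>x - of_int h / of_int k\<bar> * of_int k"
    proof -
      have "of_int k * x - of_int h = (x - of_int h / of_int k) * of_int k"
        using kpos by (simp add: field_simps)
      then show ?thesis using kpos by (simp add: e_def abs_mult)
    qed
    also have "\<dots> < 1 / (2 * (of_int k)\<^sup>2) * of_int k"
      using close kpos by (intro mult_strict_right_mono) auto
    finally have e: "2 * of_int k * e < 1" using kpos by (simp add: field_simps power2_eq_square)
    have en: "\<bar>of_int (q n) * x - of_int (p n)\<bar> \<le> e"
      unfolding e_def using best_approximation[OF assms(1) _ ne] m n by simp
    have "1 \<le> \<bar>real_of_int (h * q n - p n * k)\<bar>" using ne
      by (simp flip: of_int_mult of_int_diff of_int_abs)
    also have "real_of_int (h * q n - p n * k) = of_int k * (of_int (q n) * x - of_int (p n)) - of_int (q n) * (of_int k * x - of_int h)"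
      by (simp add: algebra_simps)
    also have "\<bar>\<dots>\<bar> \<le> of_int k * \<bar>of_int (q n) * x - of_int (p n)\<bar> + of_int (q n) * e"
      using kpos q_pos[of n] by (intro order.trans[OF abs_triangle_ineq4]) (simp add: abs_mult e_def)
    also have "\<dots> \<le> of_int k * e + of_int k * e"
      using en qn kpos by (intro add_mono mult_left_mono mult_right_mono) (auto simp: e_def)
    finally show False using e by linarith
  qed
  then have "real_of_int h * of_int (q n) = of_int (p n) * of_int k" by (metis of_int_mult)
  then have "real_of_int h / of_int k = of_int (p n) / of_int (q n)"
    using q_pos[of n] assms(1) by (simp add: field_simps)
  then show ?thesis using qn by blast
qed

end

section \<open>Hausdorff measure\<close>

lemma hausdorff_weight_empty [simp]: "hausdorff_weight s {} = 0"
  by (simp add: hausdorff_weight_def)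

lemma hausdorff_premeasure_leI:
  assumes "E \<subseteq> (\<Union>i. U i)" "\<And>i. bounded (U i)" "\<And>i. diameter (U i) \<le> \<delta>"
    "(\<Sum>i. hausdorff_weight s (U i)) \<le> c"
  shows "hausdorff_premeasure s \<delta> E \<le> c"
  unfolding hausdorff_premeasure_def using assms by (intro INF_lower2[of U]) auto

lemma hausdorff_premeasure_cover:
  assumes "hausdorff_premeasure s \<delta> E < c"
  obtains U where "E \<subseteq> (\<Union>i. U i)" "\<And>i. bounded (U i)" "\<And>i. diameter (U i) \<le> \<delta>"
    "(\<Sum>i. hausdorff_weight s (U i)) < c"
  using assms unfolding hausdorff_premeasure_def INF_less_iff by blast

lemma hausdorff_premeasure_mono: "A \<subseteq> B \<Longrightarrow> hausdorff_premeasure s \<delta> A \<le> hausdorff_premeasure s \<delta> B"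
  unfolding hausdorff_premeasure_def by (rule INF_superset_mono) auto

lemma hausdorff_measure_mono: "A \<subseteq> B \<Longrightarrow> hausdorff_measure s A \<le> hausdorff_measure s B"
  unfolding hausdorff_measure_def by (intro SUP_mono) (use hausdorff_premeasure_mono in blast)

lemma hausdorff_premeasure_le_measure:
  "\<delta> > 0 \<Longrightarrow> hausdorff_premeasure s \<delta> A \<le> hausdorff_measure s A"
  unfolding hausdorff_measure_def by (intro SUP_upper) auto

text \<open>Near-optimal coverings of the pieces, with errors \<open>e/2\<^sup>k\<^sup>+\<^sup>1\<close>, are merged by a pairing function.\<close>

lemma hausdorff_premeasure_UN:
  fixes E :: "nat \<Rightarrow> 'a::metric_space set"
  shows "hausdorff_premeasure s \<delta> (\<Union>k. E k) \<le> (\<Sum>k. hausdorff_premeasure s \<delta> (E k))"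
proof (cases "(\<Sum>k. hausdorff_premeasure s \<delta> (E k)) = \<infinity>")
  case True
  then show ?thesis by simp
next
  case False
  then have fin: "hausdorff_premeasure s \<delta> (E k) < \<infinity>" for k
    using ennreal_suminf_lessD[of "\<lambda>k. hausdorff_premeasure s \<delta> (E k)" \<infinity> k] by (simp add: less_top)
  show ?thesis
  proof (rule ennreal_le_epsilon)
    fix e :: real assume "e > 0"
    have "\<exists>U. E k \<subseteq> (\<Union>i. U i) \<and> (\<forall>i. bounded (U i)) \<and> (\<forall>i. diameter (U i) \<le> \<delta>) \<and>
        (\<Sum>i. hausdorff_weight s (U i)) < hausdorff_premeasure s \<delta> (E k) + ennreal (e * (1/2) ^ Suc k)" for k
    proof -
      have "hausdorff_premeasure s \<delta> (E k) < hausdorff_premeasure s \<delta> (E k) + ennreal (e * (1/2) ^ Suc k)"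
        using fin[of k] \<open>e > 0\<close> 
          ennreal_add_left_cancel_less[of "hausdorff_premeasure s \<delta> (E k)" 0] by simp
      then show ?thesis by (rule hausdorff_premeasure_cover) blast
    qed
    then obtain U where U: "\<And>k. E k \<subseteq> (\<Union>i. U k i)" "\<And>k i. bounded (U k i)" "\<And>k i. diameter (U k i) \<le> \<delta>"
      "\<And>k. (\<Sum>i. hausdorff_weight s (U k i)) < hausdorff_premeasure s \<delta> (E k) + ennreal (e * (1/2) ^ Suc k)"
      by metis
    show "hausdorff_premeasure s \<delta> (\<Union>k. E k) \<le> (\<Sum>k. hausdorff_premeasure s \<delta> (E k)) + ennreal e"
    proof (rule hausdorff_premeasure_leI)
      show "(\<Union>k. E k) \<subseteq> (\<Union>i. case_prod U (prod_decode i))"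
      proof
        fix x assume "x \<in> (\<Union>k. E k)"
        then obtain k i where "x \<in> U k i" using U(1) by blast
        then have "x \<in> case_prod U (prod_decode (prod_encode (k, i)))" by simp
        then show "x \<in> (\<Union>i. case_prod U (prod_decode i))" by (rule UN_I[OF UNIV_I])
      qed
      show "bounded (case_prod U (prod_decode i))" "diameter (case_prod U (prod_decode i)) \<le> \<delta>" for i
        by (simp_all only: case_prod_beta U(2,3))
      have "(\<Sum>i. hausdorff_weight s (case_prod U (prod_decode i)))
          = (\<Sum>k. \<Sum>i. hausdorff_weight s (U k i))"
        using suminf_ennreal_2dimen[of "\<lambda>k. \<Sum>i. hausdorff_weight s (U k i)"
            "\<lambda>z. hausdorff_weight s (case_prod U z)"] by simp
      also have "\<dots> \<le> (\<Sum>k. hausdorff_premeasure s \<delta> (E k) + ennreal (e * (1/2) ^ Suc k))"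
        by (intro suminf_le less_imp_le[OF U(4)]) auto
      also have "\<dots> = (\<Sum>k. hausdorff_premeasure s \<delta> (E k)) + (\<Sum>k. ennreal (e * (1/2) ^ Suc k))"
        by (rule suminf_add[symmetric]) auto
      also have "(\<Sum>k. ennreal (e * (1/2) ^ Suc k)) = ennreal e"
        using sums_mult[OF power_half_series, of e] \<open>e > 0\<close> by (intro suminf_ennreal_eq) auto
      finally show "(\<Sum>i. hausdorff_weight s (case_prod U (prod_decode i)))
         \<le> (\<Sum>k. hausdorff_premeasure s \<delta> (E k)) + ennreal e" .
    qed
  qed
qed

text \<open>Lets one discard countably many null sets, here the points that are approximable too well.\<close>

lemma hausdorff_measure_le_of_null_cover:
  fixes A :: "'a::metric_space set"
  assumes "A \<subseteq> B \<union> (\<Union>k::nat. N k)" and null: "\<And>k. hausdorff_measure s (N k) = 0"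
  shows "hausdorff_measure s A \<le> hausdorff_measure s B"
  unfolding hausdorff_measure_def[of s A]
proof (rule SUP_least)
  fix \<delta> :: real assume "\<delta> \<in> {0<..}"
  then have \<delta>: "\<delta> > 0" by simp
  define E where "E = (\<lambda>k. case k of 0 \<Rightarrow> B | Suc k \<Rightarrow> N k)"
  have N0: "hausdorff_premeasure s \<delta> (N k) = 0" for k
    using hausdorff_premeasure_le_measure[OF \<delta>, of s "N k"] null by simp
  have "A \<subseteq> (\<Union>k. E k)"
  proof
    fix x assume "x \<in> A"
    then consider "x \<in> E 0" | k where "x \<in> E (Suc k)" using assms(1) by (auto simp: E_def)
    then show "x \<in> (\<Union>k. E k)" by cases blast+
  qed
  then have "hausdorff_premeasure s \<delta> A \<le> hausdorff_premeasure s \<delta> (\<Union>k. E k)"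
    by (rule hausdorff_premeasure_mono)
  also have "\<dots> \<le> (\<Sum>k. hausdorff_premeasure s \<delta> (E k))" by (rule hausdorff_premeasure_UN)
  also have "\<dots> = (\<Sum>k\<in>{0}. hausdorff_premeasure s \<delta> (E k))"
    by (rule suminf_finite) (auto simp: E_def N0 split: nat.split)
  also have "\<dots> \<le> hausdorff_measure s B"
    using hausdorff_premeasure_le_measure[OF \<delta>, of s B] by (simp add: E_def)
  finally show "hausdorff_premeasure s \<delta> A \<le> hausdorff_measure s B" .
qed

lemma hausdorff_premeasure_antimono:
  "\<delta> \<le> \<delta>' \<Longrightarrow> hausdorff_premeasure s \<delta>' A \<le> hausdorff_premeasure s \<delta> A"
  unfolding hausdorff_premeasure_def by (rule INF_superset_mono) (auto intro: order.trans)

text \<open>The exponent 0 needs separate treatment: there every nonempty set has weight 1, whereas a singleton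
  has weight 0 for positive exponents.\<close>

lemma hausdorff_weight_antimono:
  assumes "0 \<le> t" "t \<le> s" "bounded U" "diameter U \<le> 1"
  shows "hausdorff_weight s U \<le> hausdorff_weight t U"
proof -
  have d: "diameter U \<ge> 0" using assms(3) by (rule diameter_ge_0)
  show ?thesis
  proof (cases "t = 0")
    case True
    have "diameter U powr s \<le> 1" using powr_mono2[OF _ d assms(4), of s] assms by simp
    then show ?thesis using True by (simp add: hausdorff_weight_def)
  next
    case False
    have "diameter U powr s \<le> diameter U powr t"
      using assms d by (cases "diameter U = 0") (auto intro: powr_mono')
    then show ?thesis using False assms by (auto simp: hausdorff_weight_def intro: ennreal_leI)
  qed
qed

lemma hausdorff_measure_zero_mono:
  fixes A :: "'a::metric_space set"
  assumes "0 \<le> t" "t \<le> s" "hausdorff_measure t A = 0"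
  shows "hausdorff_measure s A = 0"
proof -
  have le: "hausdorff_premeasure s \<delta> A \<le> hausdorff_premeasure t \<delta> A" if "\<delta> \<le> 1" for \<delta>
    unfolding hausdorff_premeasure_def
    using assms that by (intro INF_mono) (auto intro!: suminf_le hausdorff_weight_antimono intro: order.trans)
  have "hausdorff_premeasure s \<delta> A \<le> 0" if "\<delta> > 0" for \<delta>
  proof -
    have "hausdorff_premeasure s \<delta> A \<le> hausdorff_premeasure s (min \<delta> 1) A"
      by (rule hausdorff_premeasure_antimono) simp
    also have "\<dots> \<le> hausdorff_premeasure t (min \<delta> 1) A" by (rule le) simp
    also have "\<dots> \<le> hausdorff_measure t A"
      using that by (intro hausdorff_premeasure_le_measure) auto
    finally show ?thesis using assms by simp
  qed
  then show ?thesis unfolding hausdorff_measure_def by (simp add: SUP_eq_const)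
qed

lemma hausdorff_dim_eqI:
  assumes "0 \<le> s" and inf: "hausdorff_measure s A \<noteq> 0"
    and null: "\<And>t. s < t \<Longrightarrow> hausdorff_measure t A = 0"
  shows "hausdorff_dim A = ereal s"
  unfolding hausdorff_dim_def
proof (rule antisym)
  show "(INF s \<in> {s. 0 \<le> s \<and> hausdorff_measure s A = 0}. ereal s) \<le> ereal s"
  proof (rule ereal_le_epsilon2)
    fix e :: real assume "e > 0"
    then show "(INF s \<in> {s. 0 \<le> s \<and> hausdorff_measure s A = 0}. ereal s) \<le> ereal s + ereal e"
      using assms by (intro INF_lower2[of "s + e"]) auto
  qed
  show "ereal s \<le> (INF s \<in> {s. 0 \<le> s \<and> hausdorff_measure s A = 0}. ereal s)"
  proof (rule INF_greatest)
    fix t assume "t \<in> {s. 0 \<le> s \<and> hausdorff_measure s A = 0}"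
    then show "ereal s \<le> ereal t"
      using hausdorff_measure_zero_mono[of t s A] inf by (cases "t \<le> s") auto
  qed
qed

definition well_approximable :: "real \<Rightarrow> real set" where
  "well_approximable \<theta> = {x. 0 < x \<and> x < 1 \<and>
     (\<forall>k. \<exists>q\<ge>k. \<exists>p\<le>q. \<bar>x - real p / real q\<bar> \<le> real q powr - \<theta>)}"

text \<open>Only \<open>q + 1\<close> fractions of denominator \<open>q\<close> occur, so the covering by balls about them costs a
  constant times the tail of the series of \<open>q powr (1 - \<theta> t)\<close>.\<close>

lemma hausdorff_measure_well_approximable:
  assumes "0 < t" and \<theta>: "\<theta> * t > 2"
  shows "hausdorff_measure t (well_approximable \<theta>) = 0"
proof -
  have \<theta>0: "\<theta> > 0" using assms by (metis less_trans zero_less_mult_pos2 zero_less_numeral)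
  define B where "B = (\<lambda>k q p. if k \<le> q \<and> p \<le> q then cball (real p / real q) (real q powr - \<theta>) else {})"
  define g where "g = (\<lambda>q::nat. (real q + 1) * (2 * real q powr - \<theta>) powr t)"
  have g0: "g q \<ge> 0" for q by (simp add: g_def)
  have summ: "summable g"
  proof (rule summable_comparison_test_ev)
    have "g q \<le> 2 powr (t + 1) * real q powr (1 - \<theta> * t)" if "q \<ge> 1" for q
    proof -
      have "g q = (real q + 1) * (2 powr t * real q powr (- \<theta> * t))"
        using that by (simp add: g_def powr_mult powr_powr)
      also have "\<dots> \<le> (2 * real q) * (2 powr t * real q powr (- \<theta> * t))"
        using that by (intro mult_right_mono) auto
      also have "\<dots> = 2 powr (t + 1) * real q powr (1 - \<theta> * t)"
        using that by (simp add: powr_add powr_diff powr_minus divide_simps)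
      finally show ?thesis .
    qed
    then show "\<forall>\<^sub>F q in sequentially. norm (g q) \<le> 2 powr (t + 1) * real q powr (1 - \<theta> * t)"
      using g0 by (auto simp: eventually_at_top_linorder intro!: exI[of _ 1])
    show "summable (\<lambda>q. 2 powr (t + 1) * real q powr (1 - \<theta> * t))"
      using \<theta> by (intro summable_mult) (simp add: summable_real_powr_iff)
  qed
  have weight: "(\<Sum>p. hausdorff_weight t (B k q p)) \<le> ennreal (if k \<le> q then g q else 0)" for k q
  proof (cases "k \<le> q")
    case True
    have "(\<Sum>p. hausdorff_weight t (B k q p)) = (\<Sum>p\<le>q. hausdorff_weight t (B k q p))"
      by (rule suminf_finite) (auto simp: B_def)
    also have "\<dots> \<le> (\<Sum>p\<le>q. ennreal ((2 * real q powr - \<theta>) powr t))"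
      using True assms(1) by (intro sum_mono) (simp add: B_def hausdorff_weight_def)
    also have "\<dots> = ennreal (g q)"
      by (simp add: g_def ennreal_mult' ennreal_of_nat_eq_real_of_nat add.commute flip: ennreal_plus)
    finally show ?thesis using True by simp
  qed (simp add: B_def)
  have "hausdorff_premeasure t \<delta> (well_approximable \<theta>) \<le> 0" if "\<delta> > 0" for \<delta>
  proof (rule ennreal_le_epsilon)
    fix e :: real assume "e > 0"
    have "(\<lambda>q. 2 * real q powr - \<theta>) \<longlonglongrightarrow> 2 * 0"
      using \<theta>0 by (intro tendsto_mult tendsto_const tendsto_neg_powr filterlim_real_sequentially) auto
    then have "\<forall>\<^sub>F q in sequentially. 2 * real q powr - \<theta> < \<delta>"
      using \<open>\<delta> > 0\<close> by (intro order_tendstoD(2)) auto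
    moreover have "\<forall>\<^sub>F k in sequentially. norm (\<Sum>i. g (i + k)) < e"
      using suminf_exist_split[OF \<open>e > 0\<close> summ] by (auto simp: eventually_at_top_linorder)
    ultimately obtain k1 k2 where "\<And>q. q \<ge> k1 \<Longrightarrow> 2 * real q powr - \<theta> < \<delta>"
      "\<And>k. k \<ge> k2 \<Longrightarrow> norm (\<Sum>i. g (i + k)) < e"
      unfolding eventually_at_top_linorder by blast
    then obtain k where k: "\<And>q. q \<ge> k \<Longrightarrow> 2 * real q powr - \<theta> < \<delta>" "norm (\<Sum>i. g (i + k)) < e"
      using that[of "max k1 k2"] by simp
    show "hausdorff_premeasure t \<delta> (well_approximable \<theta>) \<le> 0 + ennreal e"
    proof (rule hausdorff_premeasure_leI)
      show "well_approximable \<theta> \<subseteq> (\<Union>i. case_prod (B k) (prod_decode i))"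
      proof
        fix x assume "x \<in> well_approximable \<theta>"
        then obtain q p where "q \<ge> k" "p \<le> q" "\<bar>x - real p / real q\<bar> \<le> real q powr - \<theta>"
          unfolding well_approximable_def by blast
        then have "x \<in> case_prod (B k) (prod_decode (prod_encode (q, p)))"
          by (simp add: B_def dist_real_def abs_minus_commute)
        then show "x \<in> (\<Union>i. case_prod (B k) (prod_decode i))" by (rule UN_I[OF UNIV_I])
      qed
      have "bounded (B k q p)" "diameter (B k q p) \<le> \<delta>" for q p
        using k(1)[of q] that by (auto simp: B_def less_imp_le)
      then show "bounded (case_prod (B k) (prod_decode i))" "diameter (case_prod (B k) (prod_decode i)) \<le> \<delta>" for i
        by (simp_all only: case_prod_beta)
      have "(\<Sum>i. hausdorff_weight t (case_prod (B k) (prod_decode i)))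
          = (\<Sum>q. \<Sum>p. hausdorff_weight t (B k q p))"
        using suminf_ennreal_2dimen[of "\<lambda>q. \<Sum>p. hausdorff_weight t (B k q p)"
            "\<lambda>z. hausdorff_weight t (case_prod (B k) z)"] by simp
      also have "\<dots> \<le> (\<Sum>q. ennreal (if k \<le> q then g q else 0))"
        by (intro suminf_le weight) auto
      also have "\<dots> = ennreal (\<Sum>i. g (i + k))"
      proof (rule suminf_ennreal_eq)
        have "(\<lambda>i. if k \<le> i + k then g (i + k) else 0) sums (\<Sum>i. g (i + k))"
          using summ by (simp add: summable_sums)
        then show "(\<lambda>q. if k \<le> q then g q else 0) sums (\<Sum>i. g (i + k))"
          by (subst (asm) sums_iff_shift) simp
      qed (simp add: g0)
      also have "\<dots> \<le> ennreal e" using k(2) by (intro ennreal_leI) auto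
      finally show "(\<Sum>i. hausdorff_weight t (case_prod (B k) (prod_decode i))) \<le> 0 + ennreal e" by simp
    qed
  qed
  then show ?thesis unfolding hausdorff_measure_def by (simp add: SUP_eq_const)
qed

section \<open>Counting fractions in an interval\<close>

definition fractions :: "nat \<Rightarrow> real set" where
  "fractions Q = {y. \<exists>(p::int) (q::nat). 1 \<le> q \<and> q \<le> Q \<and> y = of_int p / of_nat q}"

lemma fractions_separated:
  assumes "y \<in> fractions Q" "y' \<in> fractions Q" "y \<noteq> y'"
  shows "\<bar>y - y'\<bar> \<ge> 1 / (real Q)\<^sup>2"
proof -
  obtain p q where y: "1 \<le> q" "q \<le> Q" "y = of_int p / of_nat q" using assms(1) by (auto simp: fractions_def)
  obtain p' q' where y': "1 \<le> q'" "q' \<le> Q" "y' = of_int p' / of_nat q'" using assms(2) by (auto simp: fractions_def)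
  have eq: "y - y' = of_int (p * int q' - p' * int q) / (real q * real q')"
    unfolding y(3) y'(3) using y y' by (subst diff_frac_eq) auto
  have "p * int q' - p' * int q \<noteq> 0"
  proof
    assume "p * int q' - p' * int q = 0"
    with eq have "y - y' = 0" by (simp only: of_int_0 div_0)
    then show False using assms(3) by simp
  qed
  then have "1 \<le> \<bar>p * int q' - p' * int q\<bar>" by linarith
  then have "real_of_int 1 \<le> real_of_int \<bar>p * int q' - p' * int q\<bar>" by (simp only: of_int_le_iff)
  then have "1 \<le> \<bar>real_of_int (p * int q' - p' * int q)\<bar>" by (simp only: of_int_1 of_int_abs)
  moreover have qq: "0 < real q * real q'" "real q * real q' \<le> (real Q)\<^sup>2"
    using y y' by (auto simp: power2_eq_square intro!: mult_mono)
  ultimately have "1 / (real Q)\<^sup>2 \<le> \<bar>real_of_int (p * int q' - p' * int q)\<bar> / (real q * real q')"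
    by (intro frac_le) auto
  then show ?thesis unfolding eq abs_divide using qq by simp
qed

text \<open>Fractions in \<open>[a, b]\<close> with multiplicity: all representations as numerator over denominator,
  reduced or not, with the denominator first.\<close>

definition frac_pairs :: "real \<Rightarrow> real \<Rightarrow> nat \<Rightarrow> (nat \<times> int) set" where
  "frac_pairs a b n = (SIGMA q:{1..n}. {\<lceil>a * real q\<rceil>..\<lfloor>b * real q\<rfloor>})"

lemma finite_frac_pairs [simp]: "finite (frac_pairs a b n)"
  by (simp add: frac_pairs_def)

lemma frac_pairs_iff: "(q, p) \<in> frac_pairs a b n \<longleftrightarrow>
    1 \<le> q \<and> q \<le> n \<and> a * real q \<le> of_int p \<and> of_int p \<le> b * real q"
  by (auto simp: frac_pairs_def ceiling_le_iff le_floor_iff)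

lemma card_frac_pairs:
  assumes "a < b"
  shows "(b - a) * (real n * (real n + 1) / 2) - real n \<le> card (frac_pairs a b n)"
    and "card (frac_pairs a b n) \<le> (b - a) * (real n * (real n + 1) / 2) + real n"
proof -
  have row: "(b - a) * real q - 1 \<le> card {\<lceil>a * real q\<rceil>..\<lfloor>b * real q\<rfloor>}"
    "card {\<lceil>a * real q\<rceil>..\<lfloor>b * real q\<rfloor>} \<le> (b - a) * real q + 1" for q
  proof -
    have "a * real q \<le> b * real q" using assms by (intro mult_right_mono) auto
    then have "\<lfloor>b * real q\<rfloor> - \<lceil>a * real q\<rceil> + 1 \<ge> 0" by linarith
    then have "real (card {\<lceil>a * real q\<rceil>..\<lfloor>b * real q\<rfloor>}) = of_int (\<lfloor>b * real q\<rfloor> - \<lceil>a * real q\<rceil> + 1)"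
      by simp
    then show "(b - a) * real q - 1 \<le> card {\<lceil>a * real q\<rceil>..\<lfloor>b * real q\<rfloor>}"
      "card {\<lceil>a * real q\<rceil>..\<lfloor>b * real q\<rfloor>} \<le> (b - a) * real q + 1"
      by (simp_all only: left_diff_distrib of_int_add of_int_diff) linarith+
  qed
  have c: "real (card (frac_pairs a b n)) = (\<Sum>q=1..n. real (card {\<lceil>a * real q\<rceil>..\<lfloor>b * real q\<rfloor>}))"
    unfolding frac_pairs_def by simp
  have S: "(\<Sum>q=1..n. real q) = real n * (real n + 1) / 2"
    by (induction n) (auto simp: field_simps)
  have "(\<Sum>q=1..n. (b - a) * real q - 1) \<le> (\<Sum>q=1..n. real (card {\<lceil>a * real q\<rceil>..\<lfloor>b * real q\<rfloor>}))"
    by (intro sum_mono row)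
  then show "(b - a) * (real n * (real n + 1) / 2) - real n \<le> card (frac_pairs a b n)"
    unfolding c S[symmetric] by (simp add: sum_subtractf sum_distrib_left)
  have "(\<Sum>q=1..n. real (card {\<lceil>a * real q\<rceil>..\<lfloor>b * real q\<rfloor>})) \<le> (\<Sum>q=1..n. (b - a) * real q + 1)"
    by (intro sum_mono row)
  then show "card (frac_pairs a b n) \<le> (b - a) * (real n * (real n + 1) / 2) + real n"
    unfolding c S[symmetric] by (simp add: sum.distrib sum_distrib_left)
qed

text \<open>The point is that the bound is below 1: the representations that are not in lowest terms then
  leave a positive proportion of reduced ones.\<close>

lemma sum_inverse_squares_le: "(\<Sum>d=2..n. 1 / (real d)\<^sup>2) \<le> 3 / 4"
proof (cases "n \<ge> 2")
  case True
  then have "(\<Sum>d=2..n. 1 / (real d)\<^sup>2) \<le> 3 / 4 - 1 / real n"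
  proof (induction n rule: dec_induct)
    case (step n)
    have "1 / (real (Suc n))\<^sup>2 \<le> 1 / (real n * real (Suc n))"
      using step.hyps unfolding power2_eq_square by (intro divide_left_mono mult_right_mono mult_pos_pos) auto
    also have "\<dots> = 1 / real n - 1 / real (Suc n)"
      using step.hyps by (simp add: field_simps)
    finally show ?case using step.IH step.hyps by simp
  qed (simp add: numeral_2_eq_2 power2_eq_square)
  also have "\<dots> \<le> 3 / 4" using True by simp
  finally show ?thesis .
qed simp

lemma sum_inverse_le: "(\<Sum>d=1..n. 1 / real d) \<le> 2 * sqrt n"
proof (induction n)
  case (Suc n)
  define u s where "u = sqrt (real n)" and "s = sqrt (real (Suc n))"
  have s: "0 \<le> u" "u \<le> s" "1 \<le> s" "s * s = u * u + 1" "s * s = real (Suc n)"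
    by (simp_all add: u_def s_def)
  have "1 / real (Suc n) = 1 / (s * s)" by (simp only: s(5))
  also have "\<dots> \<le> 1 / s" using s(3) by (simp add: divide_simps)
  also have "\<dots> \<le> 2 * (s - u)"
  proof -
    have "1 = (s - u) * (s + u)" using s(4) by (simp add: algebra_simps)
    also have "\<dots> \<le> (s - u) * (2 * s)" using s by (intro mult_left_mono) auto
    finally show ?thesis using s(3) by (simp add: divide_simps algebra_simps)
  qed
  finally show ?case using Suc by (simp add: u_def s_def)
qed simp

text \<open>A representation with common factor \<open>d\<close> comes from one with denominator at most \<open>Q/d\<close>. Of about
  \<open>(b - a) Q\<^sup>2 / 2\<close> representations at most the share \<open>\<Sum> 1/d\<^sup>2 \<le> 3/4\<close>, summed over \<open>d \<ge> 2\<close>, is lost,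
  up to an error of order \<open>Q powr (3/2)\<close>.\<close>

lemma card_fractions_ge:
  assumes "a < b"
  shows "(b - a) * (real Q)\<^sup>2 / 8 - real Q - (b - a + 2) * real Q * sqrt Q
     \<le> card (fractions Q \<inter> {a..b})"
    and "finite (fractions Q \<inter> {a..b})"
proof -
  define l where "l = b - a"
  have l: "l > 0" using assms by (simp add: l_def)
  define C where "C = {(q, p) \<in> frac_pairs a b Q. coprime (int q) p}"
  have "frac_pairs a b Q \<subseteq> C \<union> (\<Union>d\<in>{2..Q}. (\<lambda>(q, p). (d * q, int d * p)) ` frac_pairs a b (Q div d))"
  proof
    fix z assume "z \<in> frac_pairs a b Q"
    then obtain q p where z: "z = (q, p)" "1 \<le> q" "q \<le> Q" "a * real q \<le> of_int p" "of_int p \<le> b * real q"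
      by (cases z) (auto simp: frac_pairs_iff)
    show "z \<in> C \<union> (\<Union>d\<in>{2..Q}. (\<lambda>(q, p). (d * q, int d * p)) ` frac_pairs a b (Q div d))"
    proof (cases "coprime (int q) p")
      case True
      then show ?thesis using z by (auto simp: C_def frac_pairs_iff)
    next
      case False
      define d where "d = nat (gcd (int q) p)"
      have dd: "int d = gcd (int q) p" by (simp add: d_def)
      have "int d \<noteq> 1" "int d \<noteq> 0" using False z by (auto simp: dd coprime_iff_gcd_eq_1)
      then have d2: "d \<ge> 2" by linarith
      have "int d dvd int q" "int d dvd p" by (simp_all add: dd)
      then have "d dvd q" by simp
      then obtain q' where q': "q = d * q'" by (rule dvdE)
      obtain p' where p': "p = int d * p'" using \<open>int d dvd p\<close> by (rule dvdE)
      have "d \<le> q" using q' z(2) by (cases q') auto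
      then have "d \<le> Q" using z(3) by simp
      moreover have "(q', p') \<in> frac_pairs a b (Q div d)"
      proof -
        have "real d > 0" using d2 by simp
        moreover have "real d * (a * real q') \<le> real d * of_int p'" "real d * of_int p' \<le> real d * (b * real q')"
          using z(4,5) by (simp_all add: q' p' mult_ac)
        ultimately have "a * real q' \<le> of_int p'" "of_int p' \<le> b * real q'" by simp_all
        moreover have "q' \<ge> 1" using z(2) q' by (cases q') auto
        moreover have "q' \<le> Q div d" using z(3) q' d2 by (simp add: less_eq_div_iff_mult_less_eq mult.commute)
        ultimately show ?thesis by (simp add: frac_pairs_iff)
      qed
      ultimately have "d \<in> {2..Q}"
        and "z \<in> (\<lambda>(q, p). (d * q, int d * p)) ` frac_pairs a b (Q div d)"
        using d2 z(1,3) q' p' by (auto intro!: image_eqI[of _ _ "(q', p')"])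
      then show ?thesis by blast
    qed
  qed
  then have "card (frac_pairs a b Q) \<le> card (C \<union> (\<Union>d\<in>{2..Q}. (\<lambda>(q, p). (d * q, int d * p)) ` frac_pairs a b (Q div d)))"
    by (intro card_mono) (auto simp: C_def intro: finite_subset[OF _ finite_frac_pairs[of a b Q]])
  also have "\<dots> \<le> card C + (\<Sum>d=2..Q. card (frac_pairs a b (Q div d)))"
    by (intro order.trans[OF card_Un_le] add_left_mono order.trans[OF card_UN_le] sum_mono card_image_le) auto
  finally have 1: "real (card (frac_pairs a b Q)) \<le> card C + (\<Sum>d=2..Q. real (card (frac_pairs a b (Q div d))))"
    by (simp flip: of_nat_sum of_nat_add)
  have "(\<Sum>d=2..Q. real (card (frac_pairs a b (Q div d))))
     \<le> (\<Sum>d=2..Q. (l * (real Q)\<^sup>2 / 2) * (1 / (real d)\<^sup>2) + ((l / 2 + 1) * real Q) * (1 / real d))"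
  proof (rule sum_mono)
    fix d assume "d \<in> {2..Q}"
    then have d: "real d > 0" by simp
    define n where "n = real (Q div d)"
    have n: "0 \<le> n" "n \<le> real Q / real d"
      using of_nat_div_le_of_nat[of Q d, where ?'a = real] by (simp_all add: n_def)
    have "card (frac_pairs a b (Q div d)) \<le> l * (n * (n + 1) / 2) + n"
      using card_frac_pairs(2)[OF assms, of "Q div d"] by (simp add: l_def n_def)
    also have "\<dots> = l / 2 * (n * n) + (l / 2 + 1) * n" by (simp add: algebra_simps add_divide_distrib)
    also have "\<dots> \<le> l / 2 * ((real Q / real d) * (real Q / real d)) + (l / 2 + 1) * (real Q / real d)"
      using n l d by (intro add_mono mult_left_mono mult_mono) auto
    also have "\<dots> = (l * (real Q)\<^sup>2 / 2) * (1 / (real d)\<^sup>2) + ((l / 2 + 1) * real Q) * (1 / real d)"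
      by (simp add: power2_eq_square)
    finally show "real (card (frac_pairs a b (Q div d))) \<le> \<dots>" .
  qed
  also have "\<dots> = (l * (real Q)\<^sup>2 / 2) * (\<Sum>d=2..Q. 1 / (real d)\<^sup>2) + ((l / 2 + 1) * real Q) * (\<Sum>d=2..Q. 1 / real d)"
    by (simp only: sum.distrib sum_distrib_left)
  also have "\<dots> \<le> (l * (real Q)\<^sup>2 / 2) * (3 / 4) + ((l / 2 + 1) * real Q) * (2 * sqrt Q)"
  proof (intro add_mono mult_left_mono sum_inverse_squares_le)
    have "(\<Sum>d=2..Q. 1 / real d) \<le> (\<Sum>d=1..Q. 1 / real d)" by (intro sum_mono2) auto
    then show "(\<Sum>d=2..Q. 1 / real d) \<le> 2 * sqrt Q" using sum_inverse_le[of Q] by linarith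
  qed (use l in auto)
  finally have 2: "(\<Sum>d=2..Q. real (card (frac_pairs a b (Q div d)))) \<le> l * (real Q)\<^sup>2 * (3 / 8) + (l + 2) * real Q * sqrt Q"
    by (simp add: algebra_simps)
  have "l * (real Q * (real Q + 1) / 2) - real Q \<le> card (frac_pairs a b Q)"
    using card_frac_pairs(1)[OF assms, of Q] by (simp add: l_def)
  moreover have "l * (real Q * (real Q + 1) / 2) \<ge> l * (real Q)\<^sup>2 / 2"
    using l by (simp add: power2_eq_square algebra_simps)
  ultimately have 3: "l * (real Q)\<^sup>2 / 8 - real Q - (l + 2) * real Q * sqrt Q \<le> card C"
    using 1 2 by (simp add: algebra_simps)
  let ?f = "\<lambda>(q, p). of_int p / real q"
  have "fractions Q \<inter> {a..b} \<subseteq> ?f ` frac_pairs a b Q"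
  proof
    fix y assume "y \<in> fractions Q \<inter> {a..b}"
    then obtain p q where "1 \<le> q" "q \<le> Q" "y = of_int p / of_nat q" "a \<le> y" "y \<le> b"
      by (auto simp: fractions_def)
    then have "a * real q \<le> y * real q" "y * real q \<le> b * real q"
      by (simp_all only: mult_right_mono of_nat_0_le_iff)
    moreover have "y * real q = of_int p" using \<open>1 \<le> q\<close> \<open>y = _\<close> by simp
    ultimately have "(q, p) \<in> frac_pairs a b Q"
      using \<open>1 \<le> q\<close> \<open>q \<le> Q\<close> by (simp add: frac_pairs_iff)
    then show "y \<in> ?f ` frac_pairs a b Q" using \<open>y = _\<close> by force
  qed
  then show fin: "finite (fractions Q \<inter> {a..b})" by (rule finite_subset) simp
  have "inj_on ?f C"
  proof (rule inj_onI, clarify)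
    fix q p q' p' assume z: "(q, p) \<in> C" "(q', p') \<in> C" and eq: "of_int p / real q = of_int p' / real q'"
    then have q: "1 \<le> q" "1 \<le> q'" "coprime p (int q)" "coprime p' (int q')"
      by (auto simp: C_def frac_pairs_iff coprime_commute)
    have "real_of_int (p * int q') = of_int (p' * int q)"
      using eq q by (simp add: field_simps)
    then have "p * int q' = p' * int q" by (simp only: of_int_eq_iff)
    moreover from this have "\<bar>p\<bar> * \<bar>int q'\<bar> = \<bar>p'\<bar> * \<bar>int q\<bar>" by (simp only: abs_mult[symmetric])
    then have "\<bar>int q'\<bar> = \<bar>int q\<bar>" using coprime_crossproduct_int[OF q(3,4)] by blast
    then have "q = q'" by simp
    ultimately have "q = q' \<and> p = p'" using q by simp
    then show "q = q' \<and> p = p'" .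
  qed
  moreover have "?f ` C \<subseteq> fractions Q \<inter> {a..b}"
  proof clarify
    fix q p assume "(q, p) \<in> C"
    then have "1 \<le> q" "q \<le> Q" "a * real q \<le> of_int p" "of_int p \<le> b * real q"
      by (auto simp: C_def frac_pairs_iff)
    moreover from this have "of_int p / real q \<in> fractions Q" unfolding fractions_def by blast
    ultimately show "of_int p / real q \<in> fractions Q \<inter> {a..b}"
      by (simp add: le_divide_eq divide_le_eq)
  qed
  ultimately have "card C \<le> card (fractions Q \<inter> {a..b})" using fin by (metis card_inj_on_le)
  then show "(b - a) * (real Q)\<^sup>2 / 8 - real Q - (b - a + 2) * real Q * sqrt Q \<le> card (fractions Q \<inter> {a..b})"
    using 3 by (simp add: l_def)
qed

lemma eventually_card_fractions_ge:
  assumes "a < b"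
  shows "\<forall>\<^sub>F Q in sequentially. (b - a) * (real Q)\<^sup>2 / 16 \<le> card (fractions Q \<inter> {a..b})"
proof -
  define l where "l = b - a"
  have l: "l > 0" using assms by (simp add: l_def)
  have "\<forall>\<^sub>F Q in sequentially. l * (real Q)\<^sup>2 / 16 \<le> l * (real Q)\<^sup>2 / 8 - real Q - (l + 2) * real Q * sqrt Q"
    using l by real_asymp
  then show ?thesis
  proof eventually_elim
    case (elim Q)
    then show ?case using card_fractions_ge(1)[OF assms, of Q] unfolding l_def by (rule order.trans)
  qed
qed

section \<open>Escaping a covering by nested balls\<close>

text \<open>Separated points fall into different cells of a grid whose mesh is the separation.\<close>

lemma card_separated_le:
  fixes S :: "real set"
  assumes "finite S" "0 < g" "0 \<le> L"
    and sep: "\<And>y y'. y \<in> S \<Longrightarrow> y' \<in> S \<Longrightarrow> y \<noteq> y' \<Longrightarrow> g \<le> \<bar>y - y'\<bar>"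
    and diam: "\<And>y y'. y \<in> S \<Longrightarrow> y' \<in> S \<Longrightarrow> \<bar>y - y'\<bar> \<le> L"
  shows "card S \<le> L / g + 1"
proof (cases "S = {}")
  case False
  define m where "m = Min S"
  have m: "m \<in> S" "\<And>y. y \<in> S \<Longrightarrow> m \<le> y" using False assms(1) by (auto simp: m_def)
  let ?f = "\<lambda>y. \<lfloor>(y - m) / g\<rfloor>"
  have less: "?f y < ?f y'" if "y \<in> S" "y' \<in> S" "y < y'" for y y'
  proof -
    have "(y - m) / g + 1 = (y - m + g) / g" using \<open>0 < g\<close> by (simp add: add_divide_distrib)
    also have "\<dots> \<le> (y' - m) / g"
      using sep[of y' y] that \<open>0 < g\<close> by (intro divide_right_mono) auto
    finally have "(y - m) / g + 1 \<le> (y' - m) / g" .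
    then show ?thesis by linarith
  qed
  have "inj_on ?f S" by (rule inj_onI) (metis less less_irrefl linorder_neqE)
  moreover have "?f ` S \<subseteq> {0..\<lfloor>L / g\<rfloor>}"
    using m diam[OF _ m(1)] \<open>0 < g\<close> by (force intro!: floor_mono divide_right_mono simp: divide_nonneg_pos)
  ultimately have "card S \<le> card {0..\<lfloor>L / g\<rfloor>}" by (intro card_inj_on_le) auto
  moreover have "real (card {0..\<lfloor>L / g\<rfloor>}) = of_int \<lfloor>L / g\<rfloor> + 1"
    using assms by simp
  ultimately show ?thesis by linarith
qed (use assms in simp)

text \<open>The constant of the invariant. It is chosen such that covering sets of length at least \<open>1/Q\<^sup>2\<close> meet
  at most half of the balls guaranteed by \<open>eventually_card_fractions_ge\<close>, since \<open>3 \<cdot> 1/96 = 1/32\<close>.\<close>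

abbreviation "kappa \<equiv> (1 / 96 :: real)"

text \<open>The covering sets \<open>U i\<close> have length at most \<open>d i\<close>. The last assumption is where the gauge enters: it
  bounds the truncated lengths and follows from the finiteness of \<open>\<Sum> (d i) powr s\<close> when
  \<open>Q\<^sup>2 \<psi>(Q)\<^sup>s\<close> tends to infinity.\<close>

locale avoidance =
  fixes U :: "nat \<Rightarrow> real set" and d :: "nat \<Rightarrow> real" and \<psi> :: "nat \<Rightarrow> real"
  assumes d_nonneg: "\<And>i. 0 \<le> d i"
    and diam_le: "\<And>i x y. x \<in> U i \<Longrightarrow> y \<in> U i \<Longrightarrow> \<bar>x - y\<bar> \<le> d i"
    and summable_d: "summable d"
    and \<psi>_pos: "\<And>Q. 0 < \<psi> Q"
    and \<psi>_small: "(\<lambda>Q. (real Q)\<^sup>2 * \<psi> Q) \<longlonglongrightarrow> 0"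
    and truncated: "\<And>e. 0 < e \<Longrightarrow>
      \<forall>\<^sub>F Q in sequentially. (\<Sum>i. min (d i) (\<psi> Q)) \<le> e * (real Q)\<^sup>2 * \<psi> Q"
begin

definition load :: "real \<Rightarrow> real \<Rightarrow> real" where
  "load y R = (\<Sum>i. if U i \<inter> cball y R \<noteq> {} then d i else 0)"

lemma summable_min: "0 \<le> r \<Longrightarrow> summable (\<lambda>i. min (d i) r)"
  by (rule summable_comparison_test'[OF summable_d, of 0]) (use d_nonneg in auto)

lemma summable_load: "summable (\<lambda>i. if U i \<inter> B \<noteq> {} then d i else 0)"
  by (rule summable_comparison_test'[OF summable_d, of 0]) (use d_nonneg in auto)

lemma card_hits_le:
  assumes "1 \<le> Q" "0 < r" "2 * r * (real Q)\<^sup>2 \<le> 1" and F: "finite F" "F \<subseteq> fractions Q"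
  shows "card {y \<in> F. U i \<inter> cball y r \<noteq> {}} \<le> d i * (real Q)\<^sup>2 + 2"
proof -
  have "real (card {y \<in> F. U i \<inter> cball y r \<noteq> {}}) \<le> (d i + 2 * r) / (1 / (real Q)\<^sup>2) + 1"
  proof (rule card_separated_le)
    fix y y' assume y: "y \<in> {y \<in> F. U i \<inter> cball y r \<noteq> {}}" "y' \<in> {y \<in> F. U i \<inter> cball y r \<noteq> {}}"
    then show "1 / (real Q)\<^sup>2 \<le> \<bar>y - y'\<bar>" if "y \<noteq> y'"
      using fractions_separated that F by blast
    obtain u u' where "u \<in> U i" "\<bar>y - u\<bar> \<le> r" "u' \<in> U i" "\<bar>y' - u'\<bar> \<le> r"
      using y by (auto simp: dist_real_def)
    then show "\<bar>y - y'\<bar> \<le> d i + 2 * r" using diam_le[of u i u'] by linarith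
  qed (use assms d_nonneg[of i] in auto)
  also have "\<dots> = d i * (real Q)\<^sup>2 + 2 * r * (real Q)\<^sup>2 + 1" by (simp add: algebra_simps)
  finally show ?thesis using assms(3) by linarith
qed

text \<open>The inductive step. Each fraction in the middle half of the ball receives a score, and the average
  score is less than 1. The score counts 1 for the point \<open>z\<close> and 1 for each covering set of length
  at least \<open>1/Q\<^sup>2\<close> that meets the ball about the fraction, while the other covering sets count their
  length, truncated at the radius \<open>r\<close>, relative to the permitted load \<open>kappa * r\<close>. A score below 1 excludes the
  point and the large sets; it also excludes every set longer than \<open>r\<close>, which would count \<open>1/kappa > 1\<close>.
  So for the remaining sets the truncation has no effect, and the score is the load of the new ball.\<close>

lemma exists_child_ball:
  assumes R: "0 < R" and load: "load y R \<le> kappa * R"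
  shows "\<exists>Q\<ge>k. \<exists>y'\<in>fractions Q. cball y' (\<psi> Q) \<subseteq> cball y R \<and> \<psi> Q \<le> R / 2 \<and>
           z \<notin> cball y' (\<psi> Q) \<and> load y' (\<psi> Q) \<le> kappa * \<psi> Q"
proof -
  define F where "F = (\<lambda>Q. fractions Q \<inter> {y - R / 2..y + R / 2})"
  have F: "finite (F Q)" "F Q \<subseteq> fractions Q" for Q
    using card_fractions_ge(2)[of "y - R / 2" "y + R / 2" Q] R by (auto simp: F_def)
  have "\<forall>\<^sub>F Q in sequentially. R * (real Q)\<^sup>2 / 16 \<le> card (F Q)"
    using eventually_card_fractions_ge[of "y - R / 2" "y + R / 2"] R by (simp add: F_def)
  moreover have "\<forall>\<^sub>F Q in sequentially. (real Q)\<^sup>2 * \<psi> Q < min (1 / 2) (R / 2)"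
    using \<psi>_small R by (intro order_tendstoD(2)) auto
  moreover have "\<forall>\<^sub>F Q in sequentially. (\<Sum>i. min (d i) (\<psi> Q)) \<le> (R / 384 * kappa) * (real Q)\<^sup>2 * \<psi> Q"
    using R by (intro truncated) auto
  moreover have "\<forall>\<^sub>F Q in sequentially. 2 < R * (real Q)\<^sup>2 / 128"
    using R by real_asymp
  moreover have "\<forall>\<^sub>F Q in sequentially. Q \<ge> max 1 k" by (rule eventually_ge_at_top)
  ultimately have "\<forall>\<^sub>F Q in sequentially. Q \<ge> max 1 k \<and> R * (real Q)\<^sup>2 / 16 \<le> card (F Q) \<and>
      (real Q)\<^sup>2 * \<psi> Q < min (1 / 2) (R / 2) \<and>
      (\<Sum>i. min (d i) (\<psi> Q)) \<le> (R / 384 * kappa) * (real Q)\<^sup>2 * \<psi> Q \<and> 2 < R * (real Q)\<^sup>2 / 128"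
    by eventually_elim blast
  then obtain Q where Q: "1 \<le> Q" "k \<le> Q" "R * (real Q)\<^sup>2 / 16 \<le> card (F Q)"
      "(real Q)\<^sup>2 * \<psi> Q < 1 / 2" "(real Q)\<^sup>2 * \<psi> Q < R / 2"
      "(\<Sum>i. min (d i) (\<psi> Q)) \<le> (R / 384 * kappa) * (real Q)\<^sup>2 * \<psi> Q" "2 < R * (real Q)\<^sup>2 / 128"
    by (auto dest!: eventually_happens)
  define r where "r = \<psi> Q"
  have r: "0 < r" using \<psi>_pos by (simp add: r_def)
  have Q1: "1 \<le> (real Q)\<^sup>2" using Q(1) by (simp add: power2_eq_square mult_ge1_I)
  have "1 * r \<le> (real Q)\<^sup>2 * r" using Q1 r by (intro mult_right_mono) auto
  then have rR: "r < R / 2" using Q(5) by (simp add: r_def)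
  have sub: "cball y' r \<subseteq> cball y R" if "y' \<in> F Q" for y'
    using that rR by (auto simp: F_def dist_real_def)
  define c where "c = (\<lambda>i. if 1 \<le> d i * (real Q)\<^sup>2 then 1 else min (d i) r / (kappa * r))"
  have c0: "0 \<le> c i" for i using d_nonneg[of i] r by (simp add: c_def)
  define hit where "hit = (\<lambda>y' i. if U i \<inter> cball y' r \<noteq> {} then c i else 0)"
  have hit0: "0 \<le> hit y' i" for y' i using c0 by (simp add: hit_def)
  have c_le: "c i \<le> (real Q)\<^sup>2 * d i + d i / (kappa * r)" for i
  proof -
    have "min (d i) r / (kappa * r) \<le> d i / (kappa * r)" using r by (intro divide_right_mono) auto
    moreover have "0 \<le> (real Q)\<^sup>2 * d i" "0 \<le> d i / (kappa * r)" using d_nonneg[of i] r by auto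
    ultimately show ?thesis unfolding c_def by (auto simp: mult.commute simp del: min_less_iff_conj)
  qed
  have "hit y' i \<le> (real Q)\<^sup>2 * d i + d i / (kappa * r)" for y' i
  proof -
    have "hit y' i \<le> c i" using c0 by (simp add: hit_def)
    then show ?thesis using c_le by (rule order.trans)
  qed
  then have hit_le: "norm (hit y' i) \<le> (real Q)\<^sup>2 * d i + d i / (kappa * r)" for y' i
    using hit0[of y' i] by (simp only: real_norm_def abs_of_nonneg)
  have summ_hit: "summable (hit y')" for y'
    by (rule summable_comparison_test'[OF _ hit_le])
      (intro summable_add summable_mult summable_divide summable_d)
  define score where "score = (\<lambda>y'. (if z \<in> cball y' r then 1 else 0) + (\<Sum>i. hit y' i))"
  define meet where "meet = (\<lambda>i. if U i \<inter> cball y R \<noteq> {} then d i else 0)"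
  have summ_meet: "summable meet" unfolding meet_def by (rule summable_load)
  \<comment> \<open>A set hits at most \<open>d i * Q\<^sup>2 + 2\<close> balls:
     this is at most \<open>3 * d i * Q\<^sup>2\<close> for a large set and at most 3 for a small one.
     The sets that hit a ball inside \<open>cball y R\<close> meet \<open>cball y R\<close> itself,
     so the large ones are controlled by the load.\<close>
  have total_hit: "(\<Sum>y'\<in>F Q. hit y' i) \<le> 3 * (real Q)\<^sup>2 * meet i + 3 / (kappa * r) * min (d i) r" for i
  proof -
    have "(\<Sum>y'\<in>F Q. hit y' i) = c i * card {y' \<in> F Q. U i \<inter> cball y' r \<noteq> {}}"
      using F(1) by (simp add: hit_def sum.If_cases Int_def)
    also have "\<dots> \<le> 3 * (real Q)\<^sup>2 * meet i + 3 / (kappa * r) * min (d i) r"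
    proof (cases "U i \<inter> cball y R = {}")
      case True
      then have "{y' \<in> F Q. U i \<inter> cball y' r \<noteq> {}} = {}" using sub by blast
      then have "card {y' \<in> F Q. U i \<inter> cball y' r \<noteq> {}} = 0" by (metis card.empty)
      then show ?thesis using d_nonneg[of i] r by (simp add: meet_def)
    next
      case False
      have hits: "card {y' \<in> F Q. U i \<inter> cball y' r \<noteq> {}} \<le> d i * (real Q)\<^sup>2 + 2"
      proof (rule card_hits_le[OF Q(1) r _ F])
        have "2 * r * (real Q)\<^sup>2 = 2 * ((real Q)\<^sup>2 * \<psi> Q)" by (simp add: r_def)
        then show "2 * r * (real Q)\<^sup>2 \<le> 1" using Q(4) by linarith
      qed
      show ?thesis
      proof (cases "1 \<le> d i * (real Q)\<^sup>2")
        case True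
        then have "c i * card {y' \<in> F Q. U i \<inter> cball y' r \<noteq> {}} \<le> 3 * (real Q)\<^sup>2 * meet i"
          using hits False by (simp add: c_def meet_def mult.commute)
        moreover have "0 \<le> 3 / (kappa * r) * min (d i) r" using d_nonneg[of i] r by simp
        ultimately show ?thesis by linarith
      next
        case small: False
        have "c i * card {y' \<in> F Q. U i \<inter> cball y' r \<noteq> {}} \<le> c i * 3"
          using hits small c0 by (intro mult_left_mono) auto
        moreover have "c i = min (d i) r / (kappa * r)" using small by (simp add: c_def)
        moreover have "0 \<le> 3 * (real Q)\<^sup>2 * meet i" using d_nonneg[of i] by (simp add: meet_def)
        ultimately show ?thesis by (simp only: times_divide_eq_left) (simp add: mult.commute)
      qed
    qed
    finally show ?thesis .
  qed
  have "(\<Sum>y'\<in>F Q. score y') = card {y' \<in> F Q. z \<in> cball y' r} + (\<Sum>i. \<Sum>y'\<in>F Q. hit y' i)"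
    using F(1) suminf_sum[of "F Q" "\<lambda>y' i. hit y' i"] summ_hit
    by (simp add: score_def sum.distrib sum.If_cases Int_def)
  also have "\<dots> \<le> 2 + (3 * (real Q)\<^sup>2 * (\<Sum>i. meet i) + 3 / (kappa * r) * (\<Sum>i. min (d i) r))"
  proof (rule add_mono)
    have "real (card {y' \<in> F Q. z \<in> cball y' r}) \<le> (2 * r) / (1 / (real Q)\<^sup>2) + 1"
    proof (rule card_separated_le)
      fix u u' assume u: "u \<in> {y' \<in> F Q. z \<in> cball y' r}" "u' \<in> {y' \<in> F Q. z \<in> cball y' r}"
      then show "1 / (real Q)\<^sup>2 \<le> \<bar>u - u'\<bar>" if "u \<noteq> u'"
        using fractions_separated that F(2) by blast
      show "\<bar>u - u'\<bar> \<le> 2 * r" using u by (auto simp: dist_real_def)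
    qed (use F Q(1) r in auto)
    then show "real (card {y' \<in> F Q. z \<in> cball y' r}) \<le> 2"
      using Q(4) by (simp add: r_def mult.commute)
    have s: "summable (\<lambda>i. 3 * (real Q)\<^sup>2 * meet i)" "summable (\<lambda>i. 3 / (kappa * r) * min (d i) r)"
      using summ_meet summable_min[of r] r by (auto intro!: summable_mult simp del: min_def)
    have "(\<Sum>i. \<Sum>y'\<in>F Q. hit y' i) \<le> (\<Sum>i. 3 * (real Q)\<^sup>2 * meet i + 3 / (kappa * r) * min (d i) r)"
      by (intro suminf_le total_hit summable_sum summ_hit summable_add s)
    also have "\<dots> = 3 * (real Q)\<^sup>2 * (\<Sum>i. meet i) + 3 / (kappa * r) * (\<Sum>i. min (d i) r)"
      by (simp only: suminf_add[OF s, symmetric] suminf_mult[OF summ_meet]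
          suminf_mult[OF summable_min[OF less_imp_le[OF r]]])
    finally show "(\<Sum>i. \<Sum>y'\<in>F Q. hit y' i) \<le> \<dots>" .
  qed
  also have "\<dots> < card (F Q)"
  proof -
    have "(\<Sum>i. meet i) \<le> kappa * R" using load by (simp add: load_def meet_def)
    then have "3 * (real Q)\<^sup>2 * (\<Sum>i. meet i) \<le> 3 * (real Q)\<^sup>2 * (kappa * R)"
      by (intro mult_left_mono) auto
    moreover have "3 / (kappa * r) * (\<Sum>i. min (d i) r) \<le> 3 / (kappa * r) * ((R / 384 * kappa) * (real Q)\<^sup>2 * r)"
      using Q(6) r by (intro mult_left_mono) (auto simp: r_def)
    moreover have "3 / (kappa * r) * ((R / 384 * kappa) * (real Q)\<^sup>2 * r) = R * (real Q)\<^sup>2 / 128"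
      using r by simp
    moreover have "3 * (real Q)\<^sup>2 * (kappa * R) = R * (real Q)\<^sup>2 / 32" by simp
    ultimately show ?thesis using Q(3,7) by linarith
  qed
  finally have small: "(\<Sum>y'\<in>F Q. score y') < card (F Q)" .
  have "\<exists>y'\<in>F Q. score y' < 1"
  proof (rule ccontr)
    assume "\<not> ?thesis"
    then have "(\<Sum>y'\<in>F Q. 1) \<le> (\<Sum>y'\<in>F Q. score y')" by (intro sum_mono) (auto simp: not_less)
    then show False using small by simp
  qed
  then obtain y' where y': "y' \<in> F Q" "score y' < 1" by blast
  have sum0: "0 \<le> (\<Sum>i. hit y' i)" by (intro suminf_nonneg summ_hit hit0)
  then have z: "z \<notin> cball y' r" and sum1: "(\<Sum>i. hit y' i) < 1"
    using y'(2) by (auto simp: score_def split: if_splits)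
  have "(if U i \<inter> cball y' r \<noteq> {} then d i else 0) = kappa * r * hit y' i" for i
  proof (cases "U i \<inter> cball y' r = {}")
    case False
    have "hit y' i \<le> (\<Sum>i. hit y' i)"
      using sum_le_suminf[OF summ_hit, of "{i}" y'] hit0 by simp
    then have "c i < 1" using sum1 False by (simp add: hit_def)
    then have c: "c i = min (d i) r / (kappa * r)" by (auto simp: c_def split: if_splits)
    have "min (d i) r / (kappa * r) < 1" using \<open>c i < 1\<close> unfolding c .
    then have "min (d i) r < 1 * (kappa * r)" by (subst (asm) pos_divide_less_eq) (use r in auto)
    then have "min (d i) r < r" using r by linarith
    then have "min (d i) r = d i" using r by (auto simp: min_def split: if_splits)
    then show ?thesis using c False r by (simp add: hit_def)
  qed (simp add: hit_def)
  then have "load y' r = (\<Sum>i. kappa * r * hit y' i)" by (simp only: load_def)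
  also have "\<dots> = kappa * r * (\<Sum>i. hit y' i)" by (rule suminf_mult[OF summ_hit])
  also have "\<dots> \<le> kappa * r" using sum1 r by simp
  finally have "load y' r \<le> kappa * r" .
  moreover have "y' \<in> fractions Q" using y'(1) F(2) by blast
  ultimately show ?thesis using Q(2) sub[OF y'(1)] rR z unfolding r_def by (meson less_imp_le)
qed

text \<open>Iterating the step gives nested balls shrinking to a point \<open>x\<close>. If \<open>x\<close> were in \<open>U i\<close>, the load of every
  ball would be at least \<open>d i\<close>, although the loads tend to 0. This argument is void when \<open>d i = 0\<close>; such
  sets have at most one point, and countably many points are avoided one per step.\<close>

theorem exists_avoiding:
  assumes total: "(\<Sum>i. d i) \<le> kappa / 2" and Z: "countable Z"
  shows "\<exists>x. 0 \<le> x \<and> x \<le> 1 \<and> x \<notin> Z \<and> (\<forall>i. 0 < d i \<longrightarrow> x \<notin> U i) \<and>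
           (\<forall>k. \<exists>Q\<ge>k. \<exists>y\<in>fractions Q. \<bar>x - y\<bar> \<le> \<psi> Q)"
proof -
  define z where "z = from_nat_into (insert 0 Z)"
  have z: "range z = insert 0 Z" unfolding z_def using Z by (intro range_from_nat_into) auto
  define good where "good = (\<lambda>s. 0 < snd s \<and> load (fst s) (snd s) \<le> kappa * snd s)"
  define nxt where "nxt = (\<lambda>n s s'. cball (fst s') (snd s') \<subseteq> cball (fst s) (snd s) \<and>
     snd s' \<le> snd s / 2 \<and> z n \<notin> cball (fst s') (snd s') \<and>
     (\<exists>Q\<ge>n. fst s' \<in> fractions Q \<and> snd s' = \<psi> Q))"
  have "\<exists>f. f 0 = (1 / 2, 1 / 2) \<and> (\<forall>n. good (f n) \<and> nxt n (f n) (f (Suc n)))"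
  proof -
    have "load (1 / 2) (1 / 2) \<le> (\<Sum>i. d i)"
      unfolding load_def using d_nonneg by (intro suminf_le summable_load summable_d) auto
    then have "good (1 / 2, 1 / 2)" using total by (simp add: good_def)
    moreover have "\<exists>s'. good s' \<and> nxt n s s'" if "good s" for n s
    proof -
      obtain Q y' where "n \<le> Q" "y' \<in> fractions Q" "cball y' (\<psi> Q) \<subseteq> cball (fst s) (snd s)"
        "\<psi> Q \<le> snd s / 2" "z n \<notin> cball y' (\<psi> Q)" "load y' (\<psi> Q) \<le> kappa * \<psi> Q"
        using exists_child_ball[of "snd s" "fst s" n "z n"] \<open>good s\<close> by (auto simp: good_def)
      then have "good (y', \<psi> Q) \<and> nxt n s (y', \<psi> Q)" using \<psi>_pos by (auto simp: good_def nxt_def)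
      then show ?thesis by blast
    qed
    ultimately have "\<exists>f. \<forall>n. (good (f n) \<and> (n = 0 \<longrightarrow> f n = (1 / 2, 1 / 2))) \<and> nxt n (f n) (f (Suc n))"
      by (intro dependent_nat_choice) (metis, blast)
    then show ?thesis by blast
  qed
  then obtain f where f: "f 0 = (1 / 2, 1 / 2)" "\<And>n. good (f n)" "\<And>n. nxt n (f n) (f (Suc n))" by blast
  define B where "B = (\<lambda>n. cball (fst (f n)) (snd (f n)))"
  have "B (Suc n) \<subseteq> B n" for n using f(3)[of n] by (simp add: B_def nxt_def)
  then have "B n \<subseteq> B m" if "m \<le> n" for m n using that by (rule lift_Suc_antimono_le)
  moreover have "B n \<noteq> {}" "compact (B n)" for n using f(2)[of n] by (auto simp: B_def good_def)
  ultimately have "\<Inter> (range B) \<noteq> {}" by (intro compact_nest) auto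
  then obtain x where x: "\<And>n. x \<in> B n" by blast
  have R: "snd (f n) \<le> (1 / 2) ^ n" for n
  proof (induction n)
    case (Suc n) then show ?case using f(3)[of n] by (simp add: nxt_def)
  qed (simp add: f)
  show ?thesis
  proof (intro exI[of _ x] conjI allI impI)
    show "0 \<le> x" "x \<le> 1" using x[of 0] by (auto simp: B_def f dist_real_def abs_if split: if_splits)
    have "x \<noteq> z n" for n using x[of "Suc n"] f(3)[of n] by (auto simp: B_def nxt_def)
    then show "x \<notin> Z" using z by (metis insertCI rangeE)
    show "x \<notin> U i" if "0 < d i" for i
    proof
      assume "x \<in> U i"
      have le: "d i \<le> kappa * (1 / 2) ^ n" for n
      proof -
        have "U i \<inter> cball (fst (f n)) (snd (f n)) \<noteq> {}" using x[of n] \<open>x \<in> U i\<close> by (auto simp: B_def)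
        then have "d i \<le> load (fst (f n)) (snd (f n))"
          unfolding load_def using d_nonneg sum_le_suminf[OF summable_load[of "cball (fst (f n)) (snd (f n))"], of "{i}"] by simp
        also have "\<dots> \<le> kappa * snd (f n)" using f(2)[of n] by (simp add: good_def)
        also have "\<dots> \<le> kappa * (1 / 2) ^ n" using R by (intro mult_left_mono) auto
        finally show ?thesis .
      qed
      obtain n where n: "(1 / 2) ^ n < d i" using real_arch_pow_inv[of "d i" "1 / 2"] \<open>0 < d i\<close> by auto
      have "kappa * (1 / 2) ^ n \<le> (1 / 2) ^ n" by simp
      then show False using le[of n] n by linarith
    qed
    show "\<exists>Q\<ge>k. \<exists>y\<in>fractions Q. \<bar>x - y\<bar> \<le> \<psi> Q" for k
    proof -
      obtain Q where "k \<le> Q" "fst (f (Suc k)) \<in> fractions Q" "snd (f (Suc k)) = \<psi> Q"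
        using f(3)[of k] unfolding nxt_def by blast
      moreover from this have "\<bar>x - fst (f (Suc k))\<bar> \<le> \<psi> Q"
        using x[of "Suc k"] by (simp add: B_def dist_real_def abs_minus_commute)
      ultimately show ?thesis by blast
    qed
  qed
qed

end

section \<open>Infinite Hausdorff measure\<close>

definition approximable_set :: "(nat \<Rightarrow> real) \<Rightarrow> real set" where
  "approximable_set \<psi> = {x. 0 < x \<and> x < 1 \<and> x \<notin> \<rat> \<and>
     (\<forall>k. \<exists>Q\<ge>k. \<exists>y\<in>fractions Q. \<bar>x - y\<bar> \<le> \<psi> Q)}"

lemma min_le_powr:
  fixes a r s :: real
  assumes "0 < a" "0 < r" "0 \<le> s" "s < 1"
  shows "min a r \<le> r powr (1 - s) * a powr s"
proof (cases "a \<le> r")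
  case True
  have "a = a powr (1 - s) * a powr s" using assms by (simp flip: powr_add)
  also have "\<dots> \<le> r powr (1 - s) * a powr s"
    using True assms by (intro mult_right_mono powr_mono2) auto
  finally show ?thesis using True by simp
next
  case False
  have "r = r powr (1 - s) * r powr s" using assms by (simp flip: powr_add)
  also have "\<dots> \<le> r powr (1 - s) * a powr s"
    using False assms by (intro mult_left_mono powr_mono2) auto
  finally show ?thesis using False by simp
qed

text \<open>From a covering with bounded sum of weights, an escaping point yields the contradiction. The
  inequality \<open>min_le_powr\<close> is used twice: with \<open>r = \<delta>\<close> it turns a fine covering of bounded weight into one
  of small total length, and with \<open>r = \<psi> Q\<close> it bounds the truncated lengths. Rational points and
  degenerate covering sets are put into the countable set to be avoided.\<close>

theorem hausdorff_measure_approximable_set: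
  assumes s: "0 \<le> s" "s < 1" and pos: "\<And>Q. 0 < \<psi> Q"
    and small: "(\<lambda>Q. (real Q)\<^sup>2 * \<psi> Q) \<longlonglongrightarrow> 0"
    and large: "filterlim (\<lambda>Q. (real Q)\<^sup>2 * \<psi> Q powr s) at_top sequentially"
  shows "hausdorff_measure s (approximable_set \<psi>) = \<infinity>"
proof (rule ccontr)
  assume "hausdorff_measure s (approximable_set \<psi>) \<noteq> \<infinity>"
  then obtain M0 :: real where M0: "0 \<le> M0" "hausdorff_measure s (approximable_set \<psi>) = ennreal M0"
    by (cases "hausdorff_measure s (approximable_set \<psi>)") auto
  define M where "M = M0 + 1"
  have M: "0 < M" using M0 by (simp add: M_def)
  define \<delta> where "\<delta> = (kappa / (2 * M)) powr (1 / (1 - s))"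
  have \<delta>: "0 < \<delta>" using M by (simp add: \<delta>_def)
  have \<delta>M: "\<delta> powr (1 - s) * M = kappa / 2" using s M by (simp add: \<delta>_def powr_powr)
  have "hausdorff_premeasure s \<delta> (approximable_set \<psi>) \<le> ennreal M0"
    using hausdorff_premeasure_le_measure[OF \<delta>, of s "approximable_set \<psi>"] M0 by simp
  also have "ennreal M0 < ennreal M" using M0 by (intro ennreal_lessI) (auto simp: M_def)
  finally obtain U where U: "approximable_set \<psi> \<subseteq> (\<Union>i. U i)" "\<And>i. bounded (U i)" "\<And>i. diameter (U i) \<le> \<delta>"
    "(\<Sum>i. hausdorff_weight s (U i)) < ennreal M"
    by (rule hausdorff_premeasure_cover) (rule that; assumption)
  define w where "w = (\<lambda>i. if U i = {} then 0 else if s = 0 then 1 else diameter (U i) powr s)"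
  have w0: "0 \<le> w i" for i by (simp add: w_def)
  have "hausdorff_weight s (U i) = ennreal (w i)" for i by (simp add: w_def hausdorff_weight_def)
  then have sumw: "(\<Sum>i. ennreal (w i)) < ennreal M" using U(4) by simp
  have summ_w: "summable w"
    by (rule summable_suminf_not_top[OF w0 less_imp_neq[OF order.strict_trans[OF sumw ennreal_less_top]]])
  then have "ennreal (\<Sum>i. w i) < ennreal M" using sumw w0 by (simp add: suminf_ennreal2)
  then have w_le: "(\<Sum>i. w i) \<le> M" using M by (simp add: ennreal_less_iff suminf_nonneg summ_w w0)
  define d where "d = (\<lambda>i. diameter (U i))"
  have d0: "0 \<le> d i" for i unfolding d_def by (rule diameter_ge_0[OF U(2)])
  have min_le: "min (d i) r \<le> r powr (1 - s) * w i" if "0 < r" for i r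
  proof (cases "d i = 0")
    case True then show ?thesis using that w0[of i] by simp
  next
    case False
    then have "d i > 0" "U i \<noteq> {}" using d0[of i] by (auto simp: d_def)
    then have "w i = d i powr s" by (simp add: w_def d_def)
    then show ?thesis using min_le_powr[of "d i" r s] \<open>d i > 0\<close> that s by simp
  qed
  have d_le: "d i \<le> \<delta> powr (1 - s) * w i" for i
    using min_le[OF \<delta>, of i] U(3)[of i] by (simp add: d_def min_def split: if_splits)
  have summ_d: "summable d"
    by (rule summable_comparison_test'[of "\<lambda>i. \<delta> powr (1 - s) * w i" 0])
      (use summ_w d0 d_le in \<open>auto intro: summable_mult\<close>)
  have sum_d: "(\<Sum>i. d i) \<le> kappa / 2"
  proof -
    have "(\<Sum>i. d i) \<le> (\<Sum>i. \<delta> powr (1 - s) * w i)"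
      by (intro suminf_le d_le summ_d summable_mult summ_w)
    also have "\<dots> = \<delta> powr (1 - s) * (\<Sum>i. w i)" by (rule suminf_mult[OF summ_w])
    also have "\<dots> \<le> \<delta> powr (1 - s) * M" using w_le by (intro mult_left_mono) auto
    finally show ?thesis unfolding \<delta>M .
  qed
  interpret avoidance U d \<psi>
  proof
    show "\<bar>x - y\<bar> \<le> d i" if "x \<in> U i" "y \<in> U i" for i x y
      using diameter_bounded_bound[OF U(2) that] by (simp add: d_def dist_real_def)
    show "\<forall>\<^sub>F Q in sequentially. (\<Sum>i. min (d i) (\<psi> Q)) \<le> e * (real Q)\<^sup>2 * \<psi> Q" if "0 < e" for e
    proof -
      have "\<forall>\<^sub>F Q in sequentially. M / e \<le> (real Q)\<^sup>2 * \<psi> Q powr s"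
        using large by (simp add: filterlim_at_top)
      then show ?thesis
      proof eventually_elim
        case (elim Q)
        have summ_min: "summable (\<lambda>i. min (d i) (\<psi> Q))"
          by (rule summable_comparison_test'[OF summ_d, of 0]) (use d0 pos[of Q] in auto)
        have "(\<Sum>i. min (d i) (\<psi> Q)) \<le> (\<Sum>i. \<psi> Q powr (1 - s) * w i)"
          by (intro suminf_le min_le pos summ_min summable_mult summ_w)
        also have "\<dots> = \<psi> Q powr (1 - s) * (\<Sum>i. w i)" by (rule suminf_mult[OF summ_w])
        also have "\<dots> \<le> \<psi> Q powr (1 - s) * (e * ((real Q)\<^sup>2 * \<psi> Q powr s))"
          using w_le elim that by (intro mult_left_mono) (auto simp: divide_le_eq mult.commute)
        also have "\<dots> = e * (real Q)\<^sup>2 * (\<psi> Q powr (1 - s) * \<psi> Q powr s)" by simp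
        also have "\<psi> Q powr (1 - s) * \<psi> Q powr s = \<psi> Q" using pos[of Q] by (simp flip: powr_add)
        finally show ?case .
      qed
    qed
  qed (fact d0 summ_d pos small)+
  define Z where "Z = \<rat> \<union> (\<Union>i\<in>{i. d i = 0}. U i)"
  have "finite (U i)" if "d i = 0" for i
  proof (cases "U i = {}")
    case False
    then obtain u where "u \<in> U i" by blast
    then have "U i \<subseteq> {u}" using diam_le[of u i] that by fastforce
    then show ?thesis by (rule finite_subset) simp
  qed simp
  then have "countable (\<Union>i\<in>{i. d i = 0}. U i)"
    by (intro countable_UN) (auto intro: countable_finite)
  then have "countable Z" unfolding Z_def by (intro countable_Un countable_rat)
  then obtain x where x: "0 \<le> x" "x \<le> 1" "x \<notin> Z" "\<And>i. 0 < d i \<Longrightarrow> x \<notin> U i"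
    "\<And>k. \<exists>Q\<ge>k. \<exists>y\<in>fractions Q. \<bar>x - y\<bar> \<le> \<psi> Q"
    using exists_avoiding[OF sum_d] by blast
  have irr: "x \<notin> \<rat>" using x(3) by (simp add: Z_def)
  then have "x \<noteq> 0" "x \<noteq> 1" by auto
  then have "x \<in> approximable_set \<psi>" using x irr by (auto simp: approximable_set_def)
  then obtain i where i: "x \<in> U i" using U(1) by blast
  then have "d i \<noteq> 0" using x(3) by (auto simp: Z_def)
  then show False using x(4)[of i] i d0[of i] by simp
qed

section \<open>Level sets and irrationality exponents\<close>

context irrational_unit
begin

abbreviation "gap n \<equiv> \<bar>x - of_int (p n) / of_int (q n)\<bar>"
abbreviation "ratio n \<equiv> ln ((of_int (q n))\<^sup>2) / ln (gap n)"

lemma ln_facts: "0 \<le> ln ((real_of_int (q n))\<^sup>2)" "ln (gap n) < - ln ((real_of_int (q n))\<^sup>2)"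
proof -
  have q: "real_of_int (q n) \<ge> 1" using q_pos[of n] by simp
  then show "0 \<le> ln ((real_of_int (q n))\<^sup>2)" by simp
  have "ln (gap n) < ln (1 / (real_of_int (q n))\<^sup>2)"
    using approx_less[of n] approx_pos[of n] q by (subst ln_less_cancel_iff) auto
  also have "\<dots> = - ln ((real_of_int (q n))\<^sup>2)" using q by (simp add: ln_div)
  finally show "ln (gap n) < - ln ((real_of_int (q n))\<^sup>2)" .
qed

lemma ratio_bounds: "-1 \<le> ratio n" "ratio n \<le> 0"
proof -
  have neg: "ln (gap n) < 0" using ln_facts[of n] by linarith
  show "ratio n \<le> 0" using ln_facts(1)[of n] neg by (intro divide_nonneg_nonpos) auto
  show "-1 \<le> ratio n" using ln_facts(2)[of n] neg by (simp add: neg_le_divide_eq)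
qed

lemma limsup_ratio_bounds: "ereal (-1) \<le> limsup (\<lambda>n. ereal (ratio n))" "limsup (\<lambda>n. ereal (ratio n)) \<le> ereal 0"
proof -
  show "limsup (\<lambda>n. ereal (ratio n)) \<le> ereal 0"
    by (intro Limsup_bounded always_eventually allI) (simp only: ereal_less_eq ratio_bounds)
  show "ereal (-1) \<le> limsup (\<lambda>n. ereal (ratio n))"
    by (intro le_Limsup always_eventually allI) (simp_all only: ereal_less_eq ratio_bounds sequentially_bot not_False_eq_True)
qed

text \<open>The fractions approximating \<open>x\<close> to within \<open>\<psi>(Q)\<close> are convergents by Legendre's theorem, with denominators at
  most \<open>Q\<close>, so their ratios are at least \<open>ln (Q\<^sup>2) / ln (\<psi> Q)\<close>. They have arbitrarily large index because
  finitely many convergents stay away from \<open>x\<close>.\<close>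

lemma limsup_ratio_ge:
  assumes x: "x \<in> approximable_set \<psi>" and pos: "\<And>Q. 0 < \<psi> Q"
    and small: "(\<lambda>Q. (real Q)\<^sup>2 * \<psi> Q) \<longlonglongrightarrow> 0"
    and exponent: "(\<lambda>Q. ln ((real Q)\<^sup>2) / ln (\<psi> Q)) \<longlonglongrightarrow> - s"
  shows "ereal (- s) \<le> limsup (\<lambda>n. ereal (ratio n))"
proof (rule ccontr)
  assume "\<not> ?thesis"
  then have "limsup (\<lambda>n. ereal (ratio n)) < ereal (- s)" by (simp only: not_le)
  then obtain \<beta> where \<beta>0: "limsup (\<lambda>n. ereal (ratio n)) < ereal \<beta>" "ereal \<beta> < ereal (- s)"
    using ereal_dense2 by blast
  then have \<beta>: "limsup (\<lambda>n. ereal (ratio n)) < ereal \<beta>" "\<beta> < - s" by (simp_all only: less_ereal.simps)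
  have "\<forall>\<^sub>F n in sequentially. ereal (ratio n) < ereal \<beta>" using \<beta>(1) by (rule Limsup_lessD)
  then obtain n0 where n0: "\<And>n. n \<ge> n0 \<Longrightarrow> ratio n < \<beta>"
    by (auto simp: eventually_at_top_linorder)
  have \<psi>_le: "\<psi> Q \<le> (real Q)\<^sup>2 * \<psi> Q" if "Q \<ge> 1" for Q
  proof -
    have "1 \<le> (real Q)\<^sup>2" using that by simp
    then show ?thesis using pos[of Q] by simp
  qed
  have small': "\<forall>\<^sub>F Q in sequentially. (real Q)\<^sup>2 * \<psi> Q < e" if "0 < e" for e
    using small that by (intro order_tendstoD(2)) auto
  have "\<forall>\<^sub>F Q in sequentially. \<forall>n\<in>{..<n0}. (real Q)\<^sup>2 * \<psi> Q < gap n"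
    using approx_pos by (intro eventually_ball_finite ballI small') auto
  moreover have "\<forall>\<^sub>F Q in sequentially. (real Q)\<^sup>2 * \<psi> Q < 1 / 2" by (rule small') simp
  moreover have "\<forall>\<^sub>F Q in sequentially. \<beta> < ln ((real Q)\<^sup>2) / ln (\<psi> Q)"
    using exponent \<beta>(2) by (rule order_tendstoD(1))
  moreover have "\<forall>\<^sub>F Q in sequentially. Q \<ge> 1" by (rule eventually_ge_at_top)
  ultimately have "\<forall>\<^sub>F Q in sequentially. (\<forall>n\<in>{..<n0}. (real Q)\<^sup>2 * \<psi> Q < gap n) \<and>
     (real Q)\<^sup>2 * \<psi> Q < 1 / 2 \<and> \<beta> < ln ((real Q)\<^sup>2) / ln (\<psi> Q) \<and> Q \<ge> 1"
    by eventually_elim blast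
  then obtain K where K: "\<And>Q. Q \<ge> K \<Longrightarrow> (\<forall>n\<in>{..<n0}. (real Q)\<^sup>2 * \<psi> Q < gap n) \<and>
     (real Q)\<^sup>2 * \<psi> Q < 1 / 2 \<and> \<beta> < ln ((real Q)\<^sup>2) / ln (\<psi> Q) \<and> Q \<ge> 1"
    by (auto simp: eventually_at_top_linorder)
  obtain Q h k where "Q \<ge> K" and k: "1 \<le> (k::nat)" "k \<le> Q" and close: "\<bar>x - of_int h / of_nat k\<bar> \<le> \<psi> Q"
    using x unfolding approximable_set_def fractions_def by blast
  then have Q: "\<And>n. n < n0 \<Longrightarrow> (real Q)\<^sup>2 * \<psi> Q < gap n" "(real Q)\<^sup>2 * \<psi> Q < 1 / 2"
    "\<beta> < ln ((real Q)\<^sup>2) / ln (\<psi> Q)" "Q \<ge> 1" using K by auto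
  have "\<bar>x - of_int h / of_int (int k)\<bar> < 1 / (2 * (real_of_int (int k))\<^sup>2)"
  proof -
    have "(real k)\<^sup>2 * \<psi> Q \<le> (real Q)\<^sup>2 * \<psi> Q"
      using k pos[of Q] by (intro mult_right_mono power_mono) auto
    then have "2 * (real k)\<^sup>2 * \<psi> Q < 1" using Q(2) by linarith
    then have "\<psi> Q < 1 / (2 * (real k)\<^sup>2)" using k by (simp add: less_divide_eq mult.commute)
    then show ?thesis using close by simp
  qed
  then obtain n where n: "q n \<le> int k" "real_of_int h / of_int (int k) = of_int (p n) / of_int (q n)"
    using legendre[of "int k" h] k by auto
  have gap: "gap n \<le> \<psi> Q" using close n(2) by simp
  then have "n \<ge> n0" using Q(1)[of n] \<psi>_le[OF Q(4)] by (meson le_less_trans not_le order.strict_trans2 less_irrefl)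
  then have "ratio n < \<beta>" by (rule n0)
  have "\<psi> Q < 1" using \<psi>_le[OF Q(4)] Q(2) by linarith
  then have neg: "ln (\<psi> Q) < 0" using pos[of Q] by simp
  have "ln (gap n) \<le> ln (\<psi> Q)" using gap approx_pos[of n] by (intro ln_mono) auto
  have "real_of_int (q n) \<le> real Q" using n(1) k by linarith
  then have "ln ((real_of_int (q n))\<^sup>2) \<le> ln ((real Q)\<^sup>2)"
    using q_pos[of n] by (intro ln_mono power_mono) auto
  then have "ln ((real_of_int (q n))\<^sup>2) / (- ln (gap n)) \<le> ln ((real Q)\<^sup>2) / (- ln (\<psi> Q))"
    using \<open>ln (gap n) \<le> ln (\<psi> Q)\<close> neg ln_facts(1)[of n] by (intro frac_le) auto
  then have "ln ((real Q)\<^sup>2) / ln (\<psi> Q) \<le> ratio n" by simp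
  then show False using \<open>ratio n < \<beta>\<close> Q(3) by linarith
qed

text \<open>\<open>ratio n > - u\<close> says the same as \<open>gap n < q\<^sub>n powr (-2/u)\<close>, because \<open>ln (gap n)\<close> is negative.\<close>

lemma limsup_ratio_gtD:
  assumes u: "0 < u" and gt: "ereal (- u) < limsup (\<lambda>n. ereal (ratio n))"
  shows "x \<in> well_approximable (2 / u)"
proof -
  have "\<exists>Q\<ge>k. \<exists>P\<le>Q. \<bar>x - real P / real Q\<bar> \<le> real Q powr - (2 / u)" for k
  proof -
    have "\<not> (\<forall>\<^sub>F n in sequentially. ereal (ratio n) \<le> ereal (- u))"
      using Limsup_bounded[of "\<lambda>n. ereal (ratio n)" "ereal (- u)" sequentially] gt leD by blast
    then obtain n where n: "n \<ge> k" "- u < ratio n"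
      by (auto simp: eventually_at_top_linorder not_le)
    have q: "real_of_int (q n) \<ge> 1" using q_pos[of n] by simp
    have neg: "ln (gap n) < 0" using ln_facts[of n] by linarith
    have "ln ((real_of_int (q n))\<^sup>2) < - u * ln (gap n)"
      using n(2) neg by (simp add: neg_less_divide_eq)
    then have "2 * ln (real_of_int (q n)) < - u * ln (gap n)"
      using q by (simp add: ln_realpow)
    then have "ln (gap n) \<le> - (2 / u) * ln (real_of_int (q n))"
      using u by (simp add: field_simps)
    then have "exp (ln (gap n)) \<le> exp (- (2 / u) * ln (real_of_int (q n)))" by (simp only: exp_le_cancel_iff)
    then have "gap n \<le> real_of_int (q n) powr - (2 / u)"
      using approx_pos[of n] q by (simp only: exp_ln powr_def) (use q in auto)
    moreover have "real (nat (q n)) = of_int (q n)" "real (nat (p n)) = of_int (p n)"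
      using q_pos[of n] p_nonneg[of n] by auto
    moreover have "nat (q n) \<ge> k" using q_ge[of n] n(1) by linarith
    moreover have "nat (p n) \<le> nat (q n)" using p_le_q by (rule nat_mono)
    ultimately show ?thesis by metis
  qed
  then show ?thesis using x_pos x_less_1 by (simp add: well_approximable_def)
qed

end

lemma level_set_G_iff:
  "x \<in> level_set_G \<alpha> \<longleftrightarrow> irrational_unit x \<and>
     limsup (\<lambda>n. ereal (ln ((of_int (conv_denom x n))\<^sup>2) /
       ln \<bar>x - of_int (conv_num x n) / of_int (conv_denom x n)\<bar>)) = ereal \<alpha>"
  by (auto simp: level_set_G_def irrational_unit_def)

lemma level_set_G_empty: "\<alpha> \<notin> {-1..0} \<Longrightarrow> level_set_G \<alpha> = {}"
proof (rule ccontr)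
  assume \<alpha>: "\<alpha> \<notin> {-1..0}" and "level_set_G \<alpha> \<noteq> {}"
  then obtain x where x: "x \<in> level_set_G \<alpha>" by blast
  then interpret irrational_unit x by (simp add: level_set_G_iff)
  show False using limsup_ratio_bounds x \<alpha> by (simp add: level_set_G_iff)
qed

lemma hausdorff_measure_level_set_G_null:
  assumes "0 \<le> s" "s < t"
  shows "hausdorff_measure t (level_set_G (- s)) = 0"
proof -
  define u where "u = (s + t) / 2"
  have u: "0 < u" "s < u" "u < t" using assms by (auto simp: u_def)
  have "level_set_G (- s) \<subseteq> well_approximable (2 / u)"
  proof
    fix x assume x: "x \<in> level_set_G (- s)"
    then interpret irrational_unit x by (simp add: level_set_G_iff)
    show "x \<in> well_approximable (2 / u)" using x u by (intro limsup_ratio_gtD) (auto simp: level_set_G_iff)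
  qed
  then have "hausdorff_measure t (level_set_G (- s)) \<le> hausdorff_measure t (well_approximable (2 / u))"
    by (rule hausdorff_measure_mono)
  also have "\<dots> = 0" using u by (intro hausdorff_measure_well_approximable) (auto simp: less_divide_eq)
  finally show ?thesis by simp
qed

lemma approximable_set_zero_subset:
  assumes pos: "\<And>Q. 0 < \<psi> Q" and small: "(\<lambda>Q. (real Q)\<^sup>2 * \<psi> Q) \<longlonglongrightarrow> 0"
    and exponent: "(\<lambda>Q. ln ((real Q)\<^sup>2) / ln (\<psi> Q)) \<longlonglongrightarrow> - 0"
  shows "approximable_set \<psi> \<subseteq> level_set_G 0"
proof
  fix x assume x: "x \<in> approximable_set \<psi>"
  then interpret irrational_unit x by (simp add: approximable_set_def irrational_unit_def)
  have "ereal (- 0) \<le> limsup (\<lambda>n. ereal (ratio n))" by (rule limsup_ratio_ge[OF x pos small exponent])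
  then show "x \<in> level_set_G 0" using limsup_ratio_bounds(2)
    by (simp add: level_set_G_iff irrational_unit_axioms)
qed

text \<open>An exponent exceeding \<open>2/s\<close> exceeds one of the countably many numbers \<open>2/u\<close> with
  \<open>u = s (1 - 1/(k + 2)) < s\<close>.\<close>

lemma approximable_set_pos_subset:
  assumes s: "0 < s" and pos: "\<And>Q. 0 < \<psi> Q" and small: "(\<lambda>Q. (real Q)\<^sup>2 * \<psi> Q) \<longlonglongrightarrow> 0"
    and exponent: "(\<lambda>Q. ln ((real Q)\<^sup>2) / ln (\<psi> Q)) \<longlonglongrightarrow> - s"
  shows "approximable_set \<psi> \<subseteq> level_set_G (- s) \<union> (\<Union>k::nat. well_approximable (2 / (s * (1 - 1 / (real k + 2)))))"
proof
  fix x assume x: "x \<in> approximable_set \<psi>"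
  then interpret irrational_unit x by (simp add: approximable_set_def irrational_unit_def)
  have ge: "ereal (- s) \<le> limsup (\<lambda>n. ereal (ratio n))" by (rule limsup_ratio_ge[OF x pos small exponent])
  show "x \<in> level_set_G (- s) \<union> (\<Union>k::nat. well_approximable (2 / (s * (1 - 1 / (real k + 2)))))"
  proof (cases "limsup (\<lambda>n. ereal (ratio n)) = ereal (- s)")
    case True
    then show ?thesis by (simp add: level_set_G_iff irrational_unit_axioms)
  next
    case False
    then have "ereal (- s) < limsup (\<lambda>n. ereal (ratio n))" using ge by simp
    moreover have "(\<lambda>k. ereal (- (s * (1 - 1 / (real k + 2))))) \<longlonglongrightarrow> ereal (- s)"
      by (intro tendsto_ereal) real_asymp
    ultimately have "\<forall>\<^sub>F k in sequentially. ereal (- (s * (1 - 1 / (real k + 2)))) < limsup (\<lambda>n. ereal (ratio n))"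
      by (intro order_tendstoD(2))
    then obtain k where k: "ereal (- (s * (1 - 1 / (real k + 2)))) < limsup (\<lambda>n. ereal (ratio n))"
      by (auto dest: eventually_happens)
    have "0 < s * (1 - 1 / (real k + 2))" using s by simp
    then have "x \<in> well_approximable (2 / (s * (1 - 1 / (real k + 2))))" using k by (rule limsup_ratio_gtD)
    then show ?thesis by blast
  qed
qed

text \<open>The logarithm in \<open>\<psi>\<close> is invisible to the exponent but makes \<open>Q\<^sup>2 \<psi>(Q)\<^sup>s\<close> unbounded. For \<open>s = 0\<close>
  the latter is \<open>Q\<^sup>2\<close> whatever \<open>\<psi>\<close> is, which allows exponential decay.\<close>

lemma hausdorff_measure_level_set_G_infinite:
  assumes "0 \<le> s" "s < 1"
  shows "hausdorff_measure s (level_set_G (- s)) = \<infinity>"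
proof (cases "s = 0")
  case True
  define \<psi> where "\<psi> = (\<lambda>Q::nat. exp (- real Q))"
  have "hausdorff_measure 0 (approximable_set \<psi>) = \<infinity>"
  proof (rule hausdorff_measure_approximable_set)
    show "(\<lambda>Q. (real Q)\<^sup>2 * \<psi> Q) \<longlonglongrightarrow> 0" unfolding \<psi>_def by real_asymp
    have "filterlim (\<lambda>Q. (real Q)\<^sup>2) at_top sequentially" by real_asymp
    then show "filterlim (\<lambda>Q. (real Q)\<^sup>2 * \<psi> Q powr 0) at_top sequentially" by (simp add: \<psi>_def)
  qed (auto simp: \<psi>_def)
  moreover have "approximable_set \<psi> \<subseteq> level_set_G 0"
    by (rule approximable_set_zero_subset; (unfold \<psi>_def)?) (simp, real_asymp, simp only: ln_exp, real_asymp)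
  ultimately show ?thesis using hausdorff_measure_mono[of "approximable_set \<psi>" "level_set_G 0" 0] True
    by (simp add: top_unique)
next
  case False
  then have s: "0 < s" "s < 1" using assms by auto
  define \<tau> where "\<tau> = 2 / s"
  have \<tau>: "\<tau> > 2" "\<tau> * s = 2" "s = 2 * inverse \<tau>" using s by (auto simp: \<tau>_def field_simps)
  define \<psi> where "\<psi> = (\<lambda>Q::nat. (real Q + 1) powr - \<tau> * (1 + ln (real Q + 1)))"
  have pos: "0 < \<psi> Q" for Q unfolding \<psi>_def by (intro mult_pos_pos add_pos_nonneg) auto
  have small: "(\<lambda>Q. (real Q)\<^sup>2 * \<psi> Q) \<longlonglongrightarrow> 0" unfolding \<psi>_def using \<tau>(1) by real_asymp
  have exponent: "(\<lambda>Q. ln ((real Q)\<^sup>2) / ln (\<psi> Q)) \<longlonglongrightarrow> - s"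
    unfolding \<psi>_def \<tau>(3) using \<tau>(1) by real_asymp
  have "hausdorff_measure s (approximable_set \<psi>) = \<infinity>"
  proof (rule hausdorff_measure_approximable_set)
    have "\<psi> Q powr s = (real Q + 1) powr - 2 * (1 + ln (real Q + 1)) powr s" for Q
      unfolding \<psi>_def using \<tau>(2) by (subst powr_mult) (auto simp: powr_powr)
    moreover have "filterlim (\<lambda>Q. (real Q)\<^sup>2 * ((real Q + 1) powr - 2 * (1 + ln (real Q + 1)) powr s)) at_top sequentially"
      using s by real_asymp
    ultimately show "filterlim (\<lambda>Q. (real Q)\<^sup>2 * \<psi> Q powr s) at_top sequentially" by simp
  qed (use s pos small in auto)
  moreover have "hausdorff_measure s (approximable_set \<psi>) \<le> hausdorff_measure s (level_set_G (- s))"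
  proof (rule hausdorff_measure_le_of_null_cover)
    show "approximable_set \<psi> \<subseteq> level_set_G (- s) \<union> (\<Union>k::nat. well_approximable (2 / (s * (1 - 1 / (real k + 2)))))"
      by (rule approximable_set_pos_subset[OF s(1) pos small exponent])
    show "hausdorff_measure s (well_approximable (2 / (s * (1 - 1 / (real k + 2))))) = 0" for k
    proof (rule hausdorff_measure_well_approximable[OF s(1)])
      have "0 < 1 - 1 / (real k + 2)" "1 - 1 / (real k + 2) < 1" by simp_all
      then have "2 < 2 / (1 - 1 / (real k + 2))" by (simp add: less_divide_eq)
      also have "\<dots> = 2 / (s * (1 - 1 / (real k + 2))) * s" using s by simp
      finally show "2 < 2 / (s * (1 - 1 / (real k + 2))) * s" .
    qed
  qed
  ultimately show ?thesis by (simp add: top_unique)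
qed

theorem theorem2:
  shows "(\<forall>\<alpha>::real. -1 < \<alpha> \<and> \<alpha> \<le> 0 \<longrightarrow>
            hausdorff_dim (level_set_G \<alpha>) = ereal \<bar>\<alpha>\<bar> \<and>
            hausdorff_measure \<bar>\<alpha>\<bar> (level_set_G \<alpha>) = \<infinity>) \<and>
         (\<forall>\<alpha>::real. \<alpha> \<notin> {-1..0} \<longrightarrow> level_set_G \<alpha> = {})"
proof (intro conjI allI impI)
  fix \<alpha> :: real assume \<alpha>: "-1 < \<alpha> \<and> \<alpha> \<le> 0"
  then show inf: "hausdorff_measure \<bar>\<alpha>\<bar> (level_set_G \<alpha>) = \<infinity>"
    using hausdorff_measure_level_set_G_infinite[of "- \<alpha>"] by simp
  show "hausdorff_dim (level_set_G \<alpha>) = ereal \<bar>\<alpha>\<bar>"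
  proof (rule hausdorff_dim_eqI)
    show "hausdorff_measure t (level_set_G \<alpha>) = 0" if "\<bar>\<alpha>\<bar> < t" for t
      using hausdorff_measure_level_set_G_null[of "- \<alpha>" t] that \<alpha> by simp
  qed (simp_all add: inf)
qed (rule level_set_G_empty)

end
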